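(* Consider curvilinear moving grids whose space-time elements are given by $x,y\in\mathbb{Q}^l(\xi,\eta)\otimes P^n(\tau)$ and $t\in P^n(\tau)$, with $l\ge1$ and $n\ge1$, and a nominal solution approximation $Q_{h,i}(\xi,\eta,\tau)\in\mathbb{Q}^k(\xi,\eta)\otimes P^m(\tau)$. To numerically satisfy the geometric conservation law $$\frac{\partial}{\partial\tau}\begin{pmatrix}|J|\tau_t\\|J|\tau_x\\|J|\tau_y\end{pmatrix}+\frac{\partial}{\partial\xi}\begin{pmatrix}|J|\xi_t\\|J|\xi_x\\|J|\xi_y\end{pmatrix}+\frac{\partial}{\partial\eta}\begin{pmatrix}|J|\eta_t\\|J|\eta_x\\|J|\eta_y\end{pmatrix}=0$$ by using exact metrics of the curvilinear moving grids, the basis function $w_j^r(\xi,\eta,\tau)$ should satisfy the following requirement: $$w_j^r(\xi,\eta,\tau)\in\mathbb{Q}^{\alpha}(\xi,\eta)\otimes P^{\beta}(\tau),\qquad\text{where}\quad \alpha=\max(2l,k)\quad\text{and}\quad\beta=\max(2n,m).$$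
   Context: $P^a$ denotes univariate polynomials of degree at most $a$, and $\mathbb{Q}^a(\xi,\eta)=P^a(\xi)\otimes P^a(\eta)$. A space-time flux reconstruction (FR) scheme is used for a hyperbolic conservation law $\partial_t\boldsymbol{Q}+\partial_x\boldsymbol{F}(\boldsymbol{Q})+\partial_y\boldsymbol{G}(\boldsymbol{Q})=0$ in two space dimensions; $Q_{h,i}$ is the polynomial approximation, on a space-time element, of the $i$-th component of $\boldsymbol{Q}$. Each tensor-product space-time element in physical coordinates $(t,x,y)$ is the image of the reference element with coordinates $(\tau,\xi,\eta)\in[-1,1]^3$ under a non-singular map. Space-time slabs are used, so $t=t(\tau)$ depends on $\tau$ only. $J=\partial(t,x,y)/\partial(\tau,\xi,\eta)$ is the Jacobian matrix and $|J|=t_\tau(x_\xi y_\eta-x_\eta y_\xi)$ its determinant; subscripts denote partial derivatives, and $\tau_t,\tau_x,\tau_y,\xi_t,\xi_x,\xi_y,\eta_t,\eta_x,\eta_y$ are the entries of $J^{-1}=\partial(\tau,\xi,\eta)/\partial(t,x,y)$. The exact metrics are the polynomials $$|J|\tau_t=x_\xi y_\eta-x_\eta y_\xi,\quad |J|\tau_x=|J|\tau_y=0,$$ $$|J|\xi_t=-x_\tau y_\eta+y_\tau x_\eta,\quad |J|\xi_x=t_\tau y_\eta,\quad |J|\xi_y=-t_\tau x_\eta,$$ $$|J|\eta_t=x_\tau y_\xi-y_\tau x_\xi,\quad |J|\eta_x=-t_\tau y_\xi,\quad |J|\eta_y=t_\tau x_\xi.$$ The $w_j^r$ are the basis functions on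 the reference element, formed as tensor products of one-dimensional Lagrange polynomials rooted on the solution points of the scheme (Gauss--Legendre points in each of the directions $\xi,\eta,\tau$). They are the basis functions used in the discrete geometric conservation law: each metric term is represented by its values at the solution points through the $w_j^r$ and differentiated in that representation, e.g. $\partial_\xi(|J|\xi_x)$ is computed as $\sum_j(|J|\xi_x)_j\,\partial_\xi w_j^r$, where $(\cdot)_j$ is the value at the $j$-th solution point. The geometric conservation law is numerically satisfied when it holds in this discrete form; errors at the level of machine zero are neglected. *)

theory Defs
  imports "HOL-Analysis.Analysis" "HOL-Computational_Algebra.Polynomial"
begin

text \<open>
  Functions on the reference element take their arguments in the order
  \<open>\<xi>\<close>, \<open>\<eta>\<close>, \<open>\<tau>\<close>.
\<close>

definition d_xi :: "(real \<Rightarrow> real \<Rightarrow> real \<Rightarrow> real) \<Rightarrow> real \<Rightarrow> real \<Rightarrow> real \<Rightarrow> real" where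
  "d_xi f \<xi> \<eta> \<tau> = deriv (\<lambda>u. f u \<eta> \<tau>) \<xi>"

definition d_eta :: "(real \<Rightarrow> real \<Rightarrow> real \<Rightarrow> real) \<Rightarrow> real \<Rightarrow> real \<Rightarrow> real \<Rightarrow> real" where
  "d_eta f \<xi> \<eta> \<tau> = deriv (\<lambda>v. f \<xi> v \<tau>) \<eta>"

definition d_tau :: "(real \<Rightarrow> real \<Rightarrow> real \<Rightarrow> real) \<Rightarrow> real \<Rightarrow> real \<Rightarrow> real \<Rightarrow> real" where
  "d_tau f \<xi> \<eta> \<tau> = deriv (\<lambda>s. f \<xi> \<eta> s) \<tau>"


subsection \<open>Polynomial spaces\<close>

definition Pspace :: "nat \<Rightarrow> (real \<Rightarrow> real) set" where
  "Pspace a = {poly p | p. degree p \<le> a}"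

text \<open>
  \<open>QPspace a b\<close> is \<open>P\<^sup>a(\<xi>) \<otimes> P\<^sup>a(\<eta>) \<otimes> P\<^sup>b(\<tau>)\<close>: finite sums of elementary tensors,
  realised as functions.
\<close>

definition QPspace :: "nat \<Rightarrow> nat \<Rightarrow> (real \<Rightarrow> real \<Rightarrow> real \<Rightarrow> real) set" where
  "QPspace a b = {f. \<exists>(N::nat) p q r.
      (\<forall>i<N. p i \<in> Pspace a \<and> q i \<in> Pspace a \<and> r i \<in> Pspace b) \<and>
      f = (\<lambda>\<xi> \<eta> \<tau>. \<Sum>i<N. p i \<xi> * q i \<eta> * r i \<tau>)}"


subsection \<open>Gauss--Legendre points and the Lagrange basis\<close>

text \<open>Rodrigues' formula.\<close>

definition legendre_poly :: "nat \<Rightarrow> real poly" where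
  "legendre_poly N = smult (1 / (2 ^ N * fact N)) ((pderiv ^^ N) ([:-1, 0, 1:] ^ N))"

definition GL_points :: "nat \<Rightarrow> real set" where
  "GL_points N = {z. poly (legendre_poly N) z = 0}"

definition lagrange :: "real set \<Rightarrow> real \<Rightarrow> real \<Rightarrow> real" where
  "lagrange S p u = (\<Prod>q\<in>S - {p}. (u - q) / (p - q))"

text \<open>
  A basis of degree \<open>a\<close> in each of \<open>\<xi>\<close>, \<open>\<eta>\<close> and degree \<open>b\<close> in \<open>\<tau>\<close> is rooted on
  \<open>a + 1\<close>, \<open>a + 1\<close>, \<open>b + 1\<close> points. Basis functions are indexed by the solution points
  themselves, so the index \<open>j = (p, q, s)\<close> is the \<open>j\<close>-th solution point.
\<close>

definition solution_points :: "nat \<Rightarrow> nat \<Rightarrow> (real \<times> real \<times> real) set" where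
  "solution_points a b = GL_points (a + 1) \<times> GL_points (a + 1) \<times> GL_points (b + 1)"

definition basis :: "nat \<Rightarrow> nat \<Rightarrow> real \<times> real \<times> real \<Rightarrow> real \<Rightarrow> real \<Rightarrow> real \<Rightarrow> real" where
  "basis a b = (\<lambda>(p, q, s) \<xi> \<eta> \<tau>.
     lagrange (GL_points (a + 1)) p \<xi> * lagrange (GL_points (a + 1)) q \<eta> *
     lagrange (GL_points (b + 1)) s \<tau>)"

definition represents_solutions :: "nat \<Rightarrow> nat \<Rightarrow> nat \<Rightarrow> nat \<Rightarrow> bool" where
  "represents_solutions k m a b \<longleftrightarrow> (\<forall>Q\<in>QPspace k m. \<exists>c.
     Q = (\<lambda>\<xi> \<eta> \<tau>. \<Sum>j\<in>solution_points a b. c j * basis a b j \<xi> \<eta> \<tau>))"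


subsection \<open>Space-time elements and exact metrics\<close>

text \<open>
  Rows are ordered \<open>t, x, y\<close> and columns \<open>\<tau>, \<xi>, \<eta>\<close>; \<open>t\<close> depends on \<open>\<tau>\<close> only.
\<close>

definition jacobian ::
  "(real \<Rightarrow> real \<Rightarrow> real \<Rightarrow> real) \<Rightarrow> (real \<Rightarrow> real \<Rightarrow> real \<Rightarrow> real) \<Rightarrow> (real \<Rightarrow> real)
    \<Rightarrow> real \<Rightarrow> real \<Rightarrow> real \<Rightarrow> real^3^3" where
  "jacobian x y t \<xi> \<eta> \<tau> = vector
     [vector [deriv t \<tau>, 0, 0],
      vector [d_tau x \<xi> \<eta> \<tau>, d_xi x \<xi> \<eta> \<tau>, d_eta x \<xi> \<eta> \<tau>],
      vector [d_tau y \<xi> \<eta> \<tau>, d_xi y \<xi> \<eta> \<tau>, d_eta y \<xi> \<eta> \<tau>]]"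

definition space_time_element ::
  "nat \<Rightarrow> nat \<Rightarrow> (real \<Rightarrow> real \<Rightarrow> real \<Rightarrow> real) \<Rightarrow> (real \<Rightarrow> real \<Rightarrow> real \<Rightarrow> real)
    \<Rightarrow> (real \<Rightarrow> real) \<Rightarrow> bool" where
  "space_time_element l n x y t \<longleftrightarrow>
     x \<in> QPspace l n \<and> y \<in> QPspace l n \<and> t \<in> Pspace n \<and>
     (\<forall>\<xi>\<in>{-1..1}. \<forall>\<eta>\<in>{-1..1}. \<forall>\<tau>\<in>{-1..1}. invertible (jacobian x y t \<xi> \<eta> \<tau>))"

text \<open>
  The columns of the geometric conservation law, e.g. \<open>metric_xi\<close> is
  \<open>(|J| \<xi>\<^sub>t, |J| \<xi>\<^sub>x, |J| \<xi>\<^sub>y)\<close>.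
\<close>

definition metric_tau ::
  "(real \<Rightarrow> real \<Rightarrow> real \<Rightarrow> real) \<Rightarrow> (real \<Rightarrow> real \<Rightarrow> real \<Rightarrow> real) \<Rightarrow> (real \<Rightarrow> real)
    \<Rightarrow> real \<Rightarrow> real \<Rightarrow> real \<Rightarrow> real^3" where
  "metric_tau x y t \<xi> \<eta> \<tau> = vector
     [d_xi x \<xi> \<eta> \<tau> * d_eta y \<xi> \<eta> \<tau> - d_eta x \<xi> \<eta> \<tau> * d_xi y \<xi> \<eta> \<tau>,
      0,
      0]"

definition metric_xi ::
  "(real \<Rightarrow> real \<Rightarrow> real \<Rightarrow> real) \<Rightarrow> (real \<Rightarrow> real \<Rightarrow> real \<Rightarrow> real) \<Rightarrow> (real \<Rightarrow> real)
    \<Rightarrow> real \<Rightarrow> real \<Rightarrow> real \<Rightarrow> real^3" where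
  "metric_xi x y t \<xi> \<eta> \<tau> = vector
     [- d_tau x \<xi> \<eta> \<tau> * d_eta y \<xi> \<eta> \<tau> + d_tau y \<xi> \<eta> \<tau> * d_eta x \<xi> \<eta> \<tau>,
      deriv t \<tau> * d_eta y \<xi> \<eta> \<tau>,
      - deriv t \<tau> * d_eta x \<xi> \<eta> \<tau>]"

definition metric_eta ::
  "(real \<Rightarrow> real \<Rightarrow> real \<Rightarrow> real) \<Rightarrow> (real \<Rightarrow> real \<Rightarrow> real \<Rightarrow> real) \<Rightarrow> (real \<Rightarrow> real)
    \<Rightarrow> real \<Rightarrow> real \<Rightarrow> real \<Rightarrow> real^3" where
  "metric_eta x y t \<xi> \<eta> \<tau> = vector
     [d_tau x \<xi> \<eta> \<tau> * d_xi y \<xi> \<eta> \<tau> - d_tau y \<xi> \<eta> \<tau> * d_xi x \<xi> \<eta> \<tau>,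
      - deriv t \<tau> * d_xi y \<xi> \<eta> \<tau>,
      deriv t \<tau> * d_xi x \<xi> \<eta> \<tau>]"

lemma det_jacobian:
  "det (jacobian x y t \<xi> \<eta> \<tau>) =
     deriv t \<tau> * (d_xi x \<xi> \<eta> \<tau> * d_eta y \<xi> \<eta> \<tau> - d_eta x \<xi> \<eta> \<tau> * d_xi y \<xi> \<eta> \<tau>)"
  by (simp add: jacobian_def det_3 algebra_simps)

text \<open>The metrics are \<open>|J|\<close> times the rows of the inverse Jacobian matrix.\<close>

lemma metrics_inverse_jacobian:
  assumes inv: "invertible (jacobian x y t \<xi> \<eta> \<tau>)"
  defines "J \<equiv> jacobian x y t \<xi> \<eta> \<tau>"
  shows "metric_tau x y t \<xi> \<eta> \<tau> = det J *\<^sub>R (matrix_inv J $ 1)"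
    and "metric_xi x y t \<xi> \<eta> \<tau> = det J *\<^sub>R (matrix_inv J $ 2)"
    and "metric_eta x y t \<xi> \<eta> \<tau> = det J *\<^sub>R (matrix_inv J $ 3)"
proof -
  define M :: "real^3^3" where
    "M = vector [metric_tau x y t \<xi> \<eta> \<tau>, metric_xi x y t \<xi> \<eta> \<tau>, metric_eta x y t \<xi> \<eta> \<tau>]"
  have "M ** J = det J *\<^sub>R mat 1"
    unfolding J_def det_jacobian
    by (simp add: M_def metric_tau_def metric_xi_def metric_eta_def jacobian_def vec_eq_iff
        forall_3 matrix_matrix_mult_def sum_3 mat_def algebra_simps)
  then have "(M ** J) ** matrix_inv J = det J *\<^sub>R matrix_inv J"
    by (simp add: matrix_matrix_mult_def vec_eq_iff sum_3 mat_def forall_3)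
  moreover have "J ** matrix_inv J = mat 1"
    using inv unfolding J_def invertible_def matrix_inv_def by (rule someI_ex[THEN conjunct1])
  ultimately have "M = det J *\<^sub>R matrix_inv J"
    by (simp flip: matrix_mul_assoc)
  then have "M $ i = det J *\<^sub>R (matrix_inv J $ i)" for i
    by simp
  from this[of 1] this[of 2] this[of 3]
  show "metric_tau x y t \<xi> \<eta> \<tau> = det J *\<^sub>R (matrix_inv J $ 1)"
    and "metric_xi x y t \<xi> \<eta> \<tau> = det J *\<^sub>R (matrix_inv J $ 2)"
    and "metric_eta x y t \<xi> \<eta> \<tau> = det J *\<^sub>R (matrix_inv J $ 3)"
    by (simp_all add: M_def)
qed


subsection \<open>Discrete geometric conservation law\<close>

definition discrete_GCL ::
  "nat \<Rightarrow> nat \<Rightarrow> (real \<Rightarrow> real \<Rightarrow> real \<Rightarrow> real) \<Rightarrow> (real \<Rightarrow> real \<Rightarrow> real \<Rightarrow> real)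
    \<Rightarrow> (real \<Rightarrow> real) \<Rightarrow> bool" where
  "discrete_GCL a b x y t \<longleftrightarrow>
     (\<forall>\<xi>\<in>{-1..1}. \<forall>\<eta>\<in>{-1..1}. \<forall>\<tau>\<in>{-1..1}.
        (\<Sum>(p, q, s)\<in>solution_points a b.
            d_tau (basis a b (p, q, s)) \<xi> \<eta> \<tau> *\<^sub>R metric_tau x y t p q s)
      + (\<Sum>(p, q, s)\<in>solution_points a b.
            d_xi (basis a b (p, q, s)) \<xi> \<eta> \<tau> *\<^sub>R metric_xi x y t p q s)
      + (\<Sum>(p, q, s)\<in>solution_points a b.
            d_eta (basis a b (p, q, s)) \<xi> \<eta> \<tau> *\<^sub>R metric_eta x y t p q s) = 0)"

end

theory Submission
  imports Defs
begin

text \<open>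
  Write \<open>I\<close> for interpolation of a univariate function at the Gauss--Legendre points of a direction.
  On a product function \<open>f(\<xi>) g(\<eta>) h(\<tau>)\<close> a nodal derivative acts as interpolation in two directions
  and as \<open>f \<mapsto> (I f)'\<close> in the third. The exact metrics satisfy the conservation law identically, as an
  instance of the symmetry of second derivatives, so the discrete law measures how far
  differentiation is from commuting with interpolation.

  \<^emph>\<open>Sufficiency.\<close> Each metric is a sum of products of two derivatives of element coordinates, hence lies
  in \<open>Q\<^sup>2\<^sup>l \<otimes> P\<^sup>2\<^sup>n\<close>. On \<open>Q\<^sup>a \<otimes> P\<^sup>b\<close> interpolation is the identity, so for
  \<open>a \<ge> 2l\<close>, \<open>b \<ge> 2n\<close> nodal derivatives of the metrics are true derivatives
  (\<open>exact_metrics_discrete_GCL\<close>).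

  \<^emph>\<open>Necessity.\<close> Let \<open>E p = (I p)' - I p'\<close> be the commutation defect of a polynomial \<open>p\<close>. With \<open>d \<ge> 1\<close> nodes it
  vanishes in degrees below \<open>d\<close>, but not on the nodal polynomial \<open>\<omega>\<close> of degree \<open>d\<close>: there \<open>I \<omega> = 0\<close>,
  while \<open>I \<omega>' = \<omega>' \<noteq> 0\<close>. So some monomial of degree at most \<open>d\<close> has a nonzero defect
  (\<open>commutation_defect_obstruction\<close>). Two families of non-singular elements with \<open>t = \<tau>\<close> turn the
  discrete law into the vanishing of \<open>E\<close>:

    \<^item> \<open>x = \<xi> A(\<tau>)\<close>, \<open>y = \<eta> B(\<tau>)\<close> gives \<open>E (A B) = 0\<close> at the nodes in \<open>\<tau>\<close> if \<open>a \<ge> 1\<close>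
      (\<open>separable_element_GCL\<close>);
    \<^item> \<open>x = c \<xi> + \<tau> \<eta> G(\<xi>)\<close>, \<open>y = c \<eta> + \<tau> H(\<xi>)\<close> gives \<open>E (G H) = 0\<close> at the nodes in \<open>\<xi>\<close>
      if \<open>a \<ge> 1\<close> and \<open>b \<ge> 2\<close> (\<open>sheared_element_GCL\<close>).

  The condition \<open>a \<ge> 1\<close> itself comes from a separable element (\<open>GCL_imp_spatial_degree_positive\<close>).
  Since \<open>A, B\<close> range over degrees up to \<open>n\<close> and \<open>G, H\<close> over degrees up to \<open>l\<close>, all monomials of
  degree at most \<open>2n\<close> and \<open>2l\<close> respectively are free of defect, which forces at least \<open>2n + 1\<close> and
  \<open>2l + 1\<close> nodes. The remaining bounds \<open>k\<close> and \<open>m\<close> are those for representing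
  \<open>Q\<^sup>k \<otimes> P\<^sup>m\<close> (\<open>represents_solutions_iff\<close>).

  The Gauss--Legendre points enter through their number: the Legendre polynomial of degree \<open>N\<close> has
  \<open>N\<close> distinct real roots (\<open>card_GL_points\<close>).
\<close>

section \<open>Gauss--Legendre points\<close>

text \<open>
  Rolle's theorem between consecutive roots. The new roots are located strictly between the extreme
  ones so that the endpoints \<open>\<plusminus>1\<close> can be added again before the next differentiation.
\<close>
lemma pderiv_roots_between:
  fixes p :: "real poly"
  assumes "finite T" "T \<noteq> {}" "\<forall>z\<in>T. poly p z = 0"
  shows "\<exists>S. finite S \<and> card S = card T - 1 \<and> S \<subseteq> {Min T<..<Max T} \<and> (\<forall>z\<in>S. poly (pderiv p) z = 0)"
  using assms
proof (induction T rule: finite_linorder_max_induct)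
  case empty
  then show ?case by simp
next
  case (insert M T)
  show ?case
  proof (cases "T = {}")
    case True
    then show ?thesis by (intro exI[of _ "{}"]) simp
  next
    case False
    obtain S where S: "finite S" "card S = card T - 1" "S \<subseteq> {Min T<..<Max T}"
      "\<forall>z\<in>S. poly (pderiv p) z = 0"
      using insert.IH insert.prems False by auto
    have lt: "Max T < M"
      using insert.hyps False by simp
    have "poly p (Max T) = 0" "poly p M = 0"
      using insert.prems insert.hyps(1) False by auto
    with poly_MVT[OF lt, of p] lt obtain z
      where z: "Max T < z" "z < M" "poly (pderiv p) z = 0"
      by auto
    have "z \<notin> S"
      using S(3) z(1) by auto
    have "card T \<ge> 1"
      using insert.hyps(1) False by (simp add: Suc_le_eq card_gt_0_iff)
    have "M \<notin> T"
      using insert.hyps(2) by auto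
    have "Min T \<le> Max T"
      using insert.hyps(1) False by simp
    have ends: "Min (insert M T) = Min T" "Max (insert M T) = M"
      using insert.hyps(1) False lt \<open>Min T \<le> Max T\<close> by (simp_all add: Max_insert Min_insert)
    show ?thesis
    proof (intro exI[of _ "insert z S"] conjI)
      show "finite (insert z S)"
        using S(1) by simp
      show "card (insert z S) = card (insert M T) - 1"
        using S(1,2) \<open>z \<notin> S\<close> \<open>card T \<ge> 1\<close> \<open>M \<notin> T\<close> insert.hyps(1) by simp
      show "insert z S \<subseteq> {Min (insert M T)<..<Max (insert M T)}"
        unfolding ends using S(3) z lt \<open>Min T \<le> Max T\<close> by force
      show "\<forall>z\<in>insert z S. poly (pderiv p) z = 0"
        using S(4) z(3) by simp
    qed
  qed
qed

lemma linear_power_dvd_pderiv: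
  fixes p :: "real poly"
  assumes "[:- c, 1:] ^ Suc e dvd p"
  shows "[:- c, 1:] ^ e dvd pderiv p"
proof -
  obtain q where "p = [:- c, 1:] ^ Suc e * q"
    using assms by (rule dvdE)
  then have "pderiv p = [:- c, 1:] ^ Suc e * pderiv q + q * (smult (of_nat (Suc e)) ([:- c, 1:] ^ e) * pderiv [:- c, 1:])"
    by (simp only: pderiv_mult pderiv_power_Suc)
  also have "\<dots> = [:- c, 1:] ^ e * ([:- c, 1:] * pderiv q + q * (smult (of_nat (Suc e)) (pderiv [:- c, 1:])))"
    by (simp add: algebra_simps)
  finally show ?thesis by simp
qed

lemma linear_power_dvd_higher_pderiv:
  fixes p :: "real poly"
  assumes "[:- c, 1:] ^ N dvd p" "i \<le> N"
  shows "[:- c, 1:] ^ (N - i) dvd (pderiv ^^ i) p"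
  using assms(2)
proof (induction i)
  case 0
  then show ?case using assms(1) by simp
next
  case (Suc i)
  then have "[:- c, 1:] ^ Suc (N - Suc i) dvd (pderiv ^^ i) p"
    by (metis Suc_diff_Suc Suc_le_eq less_imp_le_nat)
  then show ?case
    by (simp add: linear_power_dvd_pderiv)
qed

text \<open>
  Derivatives of \<open>(z\<^sup>2 - 1)\<^sup>N\<close> of order \<open>i < N\<close> still vanish at both endpoints, so \<open>i\<close> interior roots become \<open>i + 2\<close> roots and Rolle's theorem returns \<open>i + 1\<close>.
\<close>
lemma higher_pderiv_roots_interior:
  assumes "i \<le> N"
  shows "\<exists>S\<subseteq>{-1<..<1}. finite S \<and> card S = i \<and>
    (\<forall>z\<in>S. poly ((pderiv ^^ i) ([:-1, 0, 1:] ^ N :: real poly)) z = 0)"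
  using assms
proof (induction i)
  case 0
  then show ?case by auto
next
  case (Suc i)
  define w :: "real poly" where "w = [:-1, 0, 1:] ^ N"
  obtain S where S: "S \<subseteq> {-1<..<1}" "finite S" "card S = i"
    "\<forall>z\<in>S. poly ((pderiv ^^ i) w) z = 0"
    using Suc by (auto simp: w_def)
  have w: "w = [:- 1, 1:] ^ N * [:- (-1), 1:] ^ N"
    unfolding w_def by (simp flip: power_mult_distrib)
  \<comment> \<open>\<open>\<plusminus>1\<close> are roots of \<open>w\<close> of order \<open>N\<close>, and each differentiation lowers the order by at most one.\<close>
  have endpoint: "poly ((pderiv ^^ i) w) c = 0" if "[:- c, 1:] ^ N dvd w" for c
  proof -
    have "[:- c, 1:] ^ 1 dvd [:- c, 1:] ^ (N - i)"
      using Suc.prems by (intro le_imp_power_dvd) simp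
    then have "[:- c, 1:] dvd (pderiv ^^ i) w"
      using linear_power_dvd_higher_pderiv[OF that, of i] Suc.prems
      by (metis Suc_leD dvd_trans power_one_right)
    then show ?thesis
      by (simp add: poly_eq_0_iff_dvd)
  qed
  have ends: "poly ((pderiv ^^ i) w) 1 = 0" "poly ((pderiv ^^ i) w) (-1) = 0"
    by (rule endpoint, subst w, rule dvd_triv_left dvd_triv_right)+
  let ?T = "insert (-1) (insert 1 S)"
  have card: "card ?T = i + 2"
    using S(1-3) by (subst card_insert_disjoint; (subst card_insert_disjoint)?) auto
  have "Min ?T = -1" "Max ?T = 1"
    by (rule Min_eqI Max_eqI; use S(1,2) in force)+
  then show ?case
    using pderiv_roots_between[of ?T "(pderiv ^^ i) w"] S ends card
    by (auto simp: w_def)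
qed

lemma degree_legendre_poly: "degree (legendre_poly N) = N"
  by (simp add: legendre_poly_def degree_higher_pderiv degree_power_eq)

lemma legendre_poly_nonzero: "legendre_poly N \<noteq> 0"
proof (cases N)
  case 0
  then show ?thesis by (simp add: legendre_poly_def)
next
  case (Suc N')
  then show ?thesis
    using degree_legendre_poly[of N] by auto
qed

lemma finite_GL_points: "finite (GL_points N)"
  unfolding GL_points_def by (rule poly_roots_finite[OF legendre_poly_nonzero])

text \<open>
  Rolle's theorem supplies \<open>N\<close> roots and the degree allows no more. This count is what makes
  interpolation at the points unique and exact up to degree \<open>N - 1\<close>.
\<close>
lemma card_GL_points: "card (GL_points N) = N"
proof (rule antisym)
  show "card (GL_points N) \<le> N"
    using card_poly_roots_bound[OF legendre_poly_nonzero, of N]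
    by (simp add: GL_points_def degree_legendre_poly)
  obtain S where S: "card S = N"
    "\<forall>z\<in>S. poly ((pderiv ^^ N) ([:-1, 0, 1:] ^ N :: real poly)) z = 0"
    using higher_pderiv_roots_interior[of N N] by auto
  then have "S \<subseteq> GL_points N"
    by (auto simp: GL_points_def legendre_poly_def)
  then show "N \<le> card (GL_points N)"
    using card_mono[OF finite_GL_points] S(1) by metis
qed

section \<open>Lagrange interpolation\<close>

definition lagrange_poly :: "real set \<Rightarrow> real \<Rightarrow> real poly" where
  "lagrange_poly S p = (\<Prod>q\<in>S - {p}. [:- q / (p - q), 1 / (p - q):])"

definition interpolant :: "real set \<Rightarrow> (real \<Rightarrow> real) \<Rightarrow> real poly" where
  "interpolant S f = (\<Sum>q\<in>S. smult (f q) (lagrange_poly S q))"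

lemma lagrange_eq_poly: "lagrange S p = poly (lagrange_poly S p)"
  by (simp add: fun_eq_iff lagrange_def lagrange_poly_def poly_prod diff_divide_distrib)

lemma lagrange_poly_node:
  assumes "finite S" "p \<in> S" "q \<in> S"
  shows "poly (lagrange_poly S p) q = (if q = p then 1 else 0)"
  using assms by (auto simp: lagrange_def simp flip: lagrange_eq_poly)

lemma degree_lagrange_poly:
  assumes "finite S" "p \<in> S"
  shows "degree (lagrange_poly S p) < card S"
proof -
  have "degree (lagrange_poly S p) \<le> (\<Sum>q\<in>S - {p}. degree [:- q / (p - q), 1 / (p - q):])"
    unfolding lagrange_poly_def
    using degree_prod_sum_le[of "S - {p}" "\<lambda>q. [:- q / (p - q), 1 / (p - q):]"] assms
    by (simp only: o_def finite_Diff)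
  also have "\<dots> \<le> (\<Sum>q\<in>S - {p}. 1)"
    by (intro sum_mono) simp
  also have "\<dots> < card S"
    using card_Diff1_less[OF assms] by simp
  finally show ?thesis .
qed

lemma poly_interpolant: "poly (interpolant S f) z = (\<Sum>q\<in>S. f q * lagrange S q z)"
  by (simp add: interpolant_def poly_sum lagrange_eq_poly)

lemma interpolant_node:
  assumes "finite S" "q \<in> S"
  shows "poly (interpolant S f) q = f q"
proof -
  have "poly (interpolant S f) q = (\<Sum>p\<in>S. if p = q then f p else 0)"
    unfolding poly_interpolant lagrange_eq_poly
    by (rule sum.cong) (use assms in \<open>auto simp: lagrange_poly_node\<close>)
  then show ?thesis
    using assms by simp
qed

lemma degree_interpolant:
  assumes "finite S" "S \<noteq> {}"
  shows "degree (interpolant S f) < card S"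
proof -
  have "degree (interpolant S f) \<le> card S - 1"
    unfolding interpolant_def
    using assms(1) degree_lagrange_poly[of S]
    by (intro degree_sum_le) (force intro: order.trans[OF degree_smult_le])+
  then show ?thesis
    using assms by (metis One_nat_def Suc_pred card_gt_0_iff le_imp_less_Suc)
qed

lemma interpolant_unique:
  assumes "finite S" "degree p < card S" "\<And>q. q \<in> S \<Longrightarrow> f q = poly p q"
  shows "interpolant S f = p"
proof (rule poly_eqI_degree[of S])
  show "degree (interpolant S f) < card S"
    using assms by (intro degree_interpolant) auto
qed (use assms in \<open>auto simp: interpolant_node\<close>)

lemma interpolant_poly:
  assumes "finite S" "degree p < card S"
  shows "interpolant S (poly p) = p"
  using assms by (intro interpolant_unique) auto

lemma interpolant_add: "interpolant S (\<lambda>z. f z + g z) = interpolant S f + interpolant S g"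
  by (simp add: interpolant_def smult_add_left sum.distrib)

lemma interpolant_cmult: "interpolant S (\<lambda>z. c * f z) = smult c (interpolant S f)"
  by (simp add: fun_eq_iff poly_interpolant sum_distrib_left mult_ac flip: poly_eq_poly_eq_iff)

lemma poly_fun_arith:
  fixes p q :: "real poly"
  shows "poly (p + q) = (\<lambda>z. poly p z + poly q z)" "poly (p * q) = (\<lambda>z. poly p z * poly q z)"
    "poly (smult c p) = (\<lambda>z. c * poly p z)"
  by (simp_all add: fun_eq_iff)

text \<open>
  The commutator of differentiation and interpolation. It takes a polynomial rather than a function
  so that the derivative under the interpolation is the formal one.
\<close>
definition commutation_defect :: "real set \<Rightarrow> real poly \<Rightarrow> real poly" where
  "commutation_defect S p =
     pderiv (interpolant S (poly p)) - interpolant S (poly (pderiv p))"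

lemma commutation_defect_add:
  "commutation_defect S (p + q) = commutation_defect S p + commutation_defect S q"
  by (simp add: commutation_defect_def pderiv_add poly_fun_arith interpolant_add)

lemma commutation_defect_smult:
  "commutation_defect S (smult c p) = smult c (commutation_defect S p)"
  by (simp add: commutation_defect_def pderiv_smult poly_fun_arith interpolant_cmult smult_diff_right)

lemma commutation_defect_low_degree:
  assumes "finite S" "degree p < card S"
  shows "commutation_defect S p = 0"
  using assms by (simp add: commutation_defect_def interpolant_poly degree_pderiv)

lemma commutation_defect_sum_monom:
  "commutation_defect S p = (\<Sum>d\<le>degree p. smult (coeff p d) (commutation_defect S (monom 1 d)))"
proof -
  have zero: "commutation_defect S 0 = 0"
    using commutation_defect_smult[of S 0 0] by simp
  have sum: "commutation_defect S (\<Sum>d\<in>A. f d) = (\<Sum>d\<in>A. commutation_defect S (f d))"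
    if "finite A" for A :: "nat set" and f
    using that by (induction A rule: finite_induct) (simp_all add: zero commutation_defect_add)
  have "commutation_defect S p = commutation_defect S (\<Sum>d\<le>degree p. monom (coeff p d) d)"
    by (simp add: poly_as_sum_of_monoms)
  also have "\<dots> = (\<Sum>d\<le>degree p. commutation_defect S (smult (coeff p d) (monom 1 d)))"
    by (simp add: sum smult_monom)
  finally show ?thesis
    by (simp add: commutation_defect_smult)
qed

text \<open>
  The nodal polynomial \<open>\<omega>\<close> interpolates to zero, but its derivative has degree below the number of
  nodes and is therefore reproduced by interpolation; so its defect is \<open>-\<omega>' \<noteq> 0\<close>. By linearity a
  monomial occurring in \<open>\<omega>\<close> must have a nonzero defect as well.
\<close>
lemma commutation_defect_obstruction:
  assumes "finite S" "S \<noteq> {}"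
  shows "\<exists>d\<le>card S. commutation_defect S (monom 1 d) \<noteq> 0"
proof (rule ccontr)
  assume "\<not> ?thesis"
  then have zero: "\<And>d. d \<le> card S \<Longrightarrow> commutation_defect S (monom 1 d) = 0"
    by blast
  define \<omega> where "\<omega> = (\<Prod>q\<in>S. [:- q, 1:])"
  have deg: "degree \<omega> = card S"
    unfolding \<omega>_def by (subst degree_prod_sum_eq) auto
  have "commutation_defect S \<omega> = 0"
    by (subst commutation_defect_sum_monom) (simp add: deg zero)
  moreover have "interpolant S (poly \<omega>) = 0"
    using assms by (intro interpolant_unique) (auto simp: \<omega>_def poly_prod card_gt_0_iff)
  ultimately have "interpolant S (poly (pderiv \<omega>)) = 0"
    by (simp add: commutation_defect_def)
  moreover have "degree (pderiv \<omega>) < card S"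
    using assms by (simp add: degree_pderiv deg card_gt_0_iff)
  ultimately have "pderiv \<omega> = 0"
    using interpolant_poly[OF assms(1)] by metis
  then show False
    using deg assms by (simp add: pderiv_eq_0_iff)
qed

section \<open>Tensor-product polynomials\<close>

lemma PspaceI: "degree p \<le> a \<Longrightarrow> poly p \<in> Pspace a"
  by (auto simp: Pspace_def)

lemma PspaceE:
  assumes "f \<in> Pspace a"
  obtains p where "f = poly p" "degree p \<le> a"
  using assms by (auto simp: Pspace_def)

lemma Pspace_monomial: "i \<le> a \<Longrightarrow> (\<lambda>u. c * u ^ i) \<in> Pspace a"
proof -
  assume "i \<le> a"
  then have "poly (monom c i) \<in> Pspace a"
    by (intro PspaceI order.trans[OF degree_monom_le])
  also have "poly (monom c i) = (\<lambda>u. c * u ^ i)"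
    by (rule ext) (rule poly_monom)
  finally show ?thesis .
qed

lemma Pspace_mono: "f \<in> Pspace a \<Longrightarrow> a \<le> a' \<Longrightarrow> f \<in> Pspace a'"
  by (auto simp: Pspace_def)

lemma Pspace_mult: "f \<in> Pspace a \<Longrightarrow> g \<in> Pspace b \<Longrightarrow> (\<lambda>u. f u * g u) \<in> Pspace (a + b)"
proof (elim PspaceE)
  fix p q assume "f = poly p" "g = poly q" "degree p \<le> a" "degree q \<le> b"
  then show ?thesis
    using PspaceI[of "p * q" "a + b"] degree_mult_le[of p q] by (simp add: poly_fun_arith)
qed

lemma Pspace_zero: "(\<lambda>u. 0) \<in> Pspace a"
  using Pspace_monomial[of 0 a 0] by simp

lemma Pspace_add: "f \<in> Pspace a \<Longrightarrow> g \<in> Pspace a \<Longrightarrow> (\<lambda>u. f u + g u) \<in> Pspace a"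
proof (elim PspaceE)
  fix p q assume "f = poly p" "g = poly q" "degree p \<le> a" "degree q \<le> a"
  then show ?thesis
    using PspaceI[of "p + q" a] degree_add_le[of p a q] by (simp add: poly_fun_arith)
qed

lemma Pspace_cmult: "f \<in> Pspace a \<Longrightarrow> (\<lambda>u. c * f u) \<in> Pspace a"
  using Pspace_mult[OF Pspace_monomial[of 0 0 c]] by simp

lemma Pspace_sum: "(\<And>i. i \<in> A \<Longrightarrow> f i \<in> Pspace a) \<Longrightarrow> (\<lambda>u. \<Sum>i\<in>A. f i u) \<in> Pspace a"
  by (induction A rule: infinite_finite_induct) (simp_all add: Pspace_zero Pspace_add)

lemma Pspace_deriv: "f \<in> Pspace a \<Longrightarrow> deriv f \<in> Pspace a"
proof (elim PspaceE)
  fix p assume p: "f = poly p" "degree p \<le> a"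
  have "deriv f = poly (pderiv p)"
    unfolding p(1) by (rule ext) (rule DERIV_imp_deriv[OF poly_DERIV])
  then show ?thesis
    using p(2) by (simp add: PspaceI degree_pderiv)
qed

lemma Pspace_has_deriv: "f \<in> Pspace a \<Longrightarrow> (f has_real_derivative deriv f u) (at u)"
  by (elim PspaceE) (metis DERIV_imp_deriv poly_DERIV)

lemma QPspaceE:
  assumes "f \<in> QPspace a b"
  obtains N :: nat and p q r where
    "\<forall>i<N. p i \<in> Pspace a \<and> q i \<in> Pspace a \<and> r i \<in> Pspace b"
    "f = (\<lambda>\<xi> \<eta> \<tau>. \<Sum>i<N. p i \<xi> * q i \<eta> * r i \<tau>)"
  using assms unfolding QPspace_def by blast

lemma QPspace_tensor:
  assumes "p \<in> Pspace a" "q \<in> Pspace a" "r \<in> Pspace b"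
  shows "(\<lambda>\<xi> \<eta> \<tau>. p \<xi> * q \<eta> * r \<tau>) \<in> QPspace a b"
  unfolding QPspace_def
  by (intro CollectI exI[of _ 1] exI[of _ "\<lambda>_. p"] exI[of _ "\<lambda>_. q"] exI[of _ "\<lambda>_. r"])
    (use assms in auto)

lemma QPspace_zero: "(\<lambda>\<xi> \<eta> \<tau>. 0) \<in> QPspace a b"
  using QPspace_tensor[OF Pspace_zero Pspace_zero Pspace_zero] by simp

lemma QPspace_add:
  assumes "f \<in> QPspace a b" "g \<in> QPspace a b"
  shows "(\<lambda>\<xi> \<eta> \<tau>. f \<xi> \<eta> \<tau> + g \<xi> \<eta> \<tau>) \<in> QPspace a b"
proof -
  obtain N :: nat and p q r where f: "\<forall>i<N. p i \<in> Pspace a \<and> q i \<in> Pspace a \<and> r i \<in> Pspace b"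
    "f = (\<lambda>\<xi> \<eta> \<tau>. \<Sum>i<N. p i \<xi> * q i \<eta> * r i \<tau>)"
    using assms(1) by (rule QPspaceE) blast
  obtain N' :: nat and p' q' r' where g: "\<forall>i<N'. p' i \<in> Pspace a \<and> q' i \<in> Pspace a \<and> r' i \<in> Pspace b"
    "g = (\<lambda>\<xi> \<eta> \<tau>. \<Sum>i<N'. p' i \<xi> * q' i \<eta> * r' i \<tau>)"
    using assms(2) by (rule QPspaceE) blast
  \<comment> \<open>The two families of elementary tensors are concatenated, the second shifted by \<open>N\<close>.\<close>
  define glue where "glue h h' i = (if i < N then h i else h' (i - N))"
    for h h' :: "nat \<Rightarrow> real \<Rightarrow> real" and i
  have split: "(\<Sum>i<N + N'. h i) = (\<Sum>i<N. h i) + (\<Sum>i<N'. h (N + i))" for h :: "nat \<Rightarrow> real"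
    by (induction N') simp_all
  show ?thesis
    unfolding QPspace_def
    by (intro CollectI exI[of _ "N + N'"] exI[of _ "glue p p'"] exI[of _ "glue q q'"] exI[of _ "glue r r'"])
      (auto simp: glue_def f g split)
qed

lemma QPspace_sum:
  "(\<And>i. i \<in> A \<Longrightarrow> f i \<in> QPspace a b) \<Longrightarrow> (\<lambda>\<xi> \<eta> \<tau>. \<Sum>i\<in>A. f i \<xi> \<eta> \<tau>) \<in> QPspace a b"
  by (induction A rule: infinite_finite_induct) (simp_all add: QPspace_zero QPspace_add)

lemma QPspace_mult:
  assumes "f \<in> QPspace a b" "g \<in> QPspace a' b'"
  shows "(\<lambda>\<xi> \<eta> \<tau>. f \<xi> \<eta> \<tau> * g \<xi> \<eta> \<tau>) \<in> QPspace (a + a') (b + b')"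
proof -
  obtain N :: nat and p q r where f: "\<forall>i<N. p i \<in> Pspace a \<and> q i \<in> Pspace a \<and> r i \<in> Pspace b"
    "f = (\<lambda>\<xi> \<eta> \<tau>. \<Sum>i<N. p i \<xi> * q i \<eta> * r i \<tau>)"
    using assms(1) by (rule QPspaceE) blast
  obtain N' :: nat and p' q' r' where g: "\<forall>i<N'. p' i \<in> Pspace a' \<and> q' i \<in> Pspace a' \<and> r' i \<in> Pspace b'"
    "g = (\<lambda>\<xi> \<eta> \<tau>. \<Sum>i<N'. p' i \<xi> * q' i \<eta> * r' i \<tau>)"
    using assms(2) by (rule QPspaceE) blast
  have "(\<lambda>\<xi> \<eta> \<tau>. \<Sum>i<N. \<Sum>j<N'. (p i \<xi> * p' j \<xi>) * (q i \<eta> * q' j \<eta>) * (r i \<tau> * r' j \<tau>))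
    \<in> QPspace (a + a') (b + b')"
    by (intro QPspace_sum QPspace_tensor Pspace_mult) (use f g in auto)
  then show ?thesis
    unfolding f(2) g(2) sum_product by (simp only: mult_ac)
qed

lemma QPspace_cmult: "f \<in> QPspace a b \<Longrightarrow> (\<lambda>\<xi> \<eta> \<tau>. c * f \<xi> \<eta> \<tau>) \<in> QPspace a b"
  using QPspace_mult[OF QPspace_tensor[OF Pspace_monomial[of 0 0 c] Pspace_monomial[of 0 0 1] Pspace_monomial[of 0 0 1]]]
  by simp

lemma QPspace_mono:
  assumes "f \<in> QPspace a b" "a \<le> a'" "b \<le> b'"
  shows "f \<in> QPspace a' b'"
  using assms(1)
proof (rule QPspaceE)
  fix N :: nat and p q r
  assume f: "\<forall>i<N. p i \<in> Pspace a \<and> q i \<in> Pspace a \<and> r i \<in> Pspace b"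
    "f = (\<lambda>\<xi> \<eta> \<tau>. \<Sum>i<N. p i \<xi> * q i \<eta> * r i \<tau>)"
  show ?thesis
    unfolding f(2) by (intro QPspace_sum QPspace_tensor) (use f assms in \<open>auto intro: Pspace_mono\<close>)
qed

text \<open>Fixing two of the three arguments turns the polynomial spaces into univariate ones, where degrees are visible.\<close>
lemma QPspace_sections:
  assumes "f \<in> QPspace a b"
  shows "(\<lambda>u. f u \<eta> \<tau>) \<in> Pspace a" "(\<lambda>v. f \<xi> v \<tau>) \<in> Pspace a" "(\<lambda>s. f \<xi> \<eta> s) \<in> Pspace b"
proof -
  obtain N :: nat and p q r where f: "\<forall>i<N. p i \<in> Pspace a \<and> q i \<in> Pspace a \<and> r i \<in> Pspace b"
    "f = (\<lambda>\<xi> \<eta> \<tau>. \<Sum>i<N. p i \<xi> * q i \<eta> * r i \<tau>)"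
    using assms by (rule QPspaceE) blast
  have "(\<lambda>u. \<Sum>i<N. (q i \<eta> * r i \<tau>) * p i u) \<in> Pspace a"
    "(\<lambda>v. \<Sum>i<N. (p i \<xi> * r i \<tau>) * q i v) \<in> Pspace a"
    "(\<lambda>s. \<Sum>i<N. (p i \<xi> * q i \<eta>) * r i s) \<in> Pspace b"
    by (intro Pspace_sum Pspace_cmult; use f in auto)+
  then show "(\<lambda>u. f u \<eta> \<tau>) \<in> Pspace a" "(\<lambda>v. f \<xi> v \<tau>) \<in> Pspace a" "(\<lambda>s. f \<xi> \<eta> s) \<in> Pspace b"
    unfolding f(2) by (simp_all add: mult_ac)
qed

lemma QPspace_has_partials:
  assumes "f \<in> QPspace a b"
  shows "((\<lambda>u. f u \<eta> \<tau>) has_real_derivative d_xi f \<xi> \<eta> \<tau>) (at \<xi>)"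
    "((\<lambda>v. f \<xi> v \<tau>) has_real_derivative d_eta f \<xi> \<eta> \<tau>) (at \<eta>)"
    "((\<lambda>s. f \<xi> \<eta> s) has_real_derivative d_tau f \<xi> \<eta> \<tau>) (at \<tau>)"
  unfolding d_xi_def d_eta_def d_tau_def
  using QPspace_sections[OF assms] by (blast intro: Pspace_has_deriv)+

lemma partials_tensor_sum:
  assumes "\<forall>i<N. p i \<in> Pspace a \<and> q i \<in> Pspace a \<and> r i \<in> Pspace b"
  shows "d_xi (\<lambda>\<xi> \<eta> \<tau>. \<Sum>i<N. p i \<xi> * q i \<eta> * r i \<tau>) = (\<lambda>\<xi> \<eta> \<tau>. \<Sum>i<N. deriv (p i) \<xi> * q i \<eta> * r i \<tau>)"
    "d_eta (\<lambda>\<xi> \<eta> \<tau>. \<Sum>i<N. p i \<xi> * q i \<eta> * r i \<tau>) = (\<lambda>\<xi> \<eta> \<tau>. \<Sum>i<N. p i \<xi> * deriv (q i) \<eta> * r i \<tau>)"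
    "d_tau (\<lambda>\<xi> \<eta> \<tau>. \<Sum>i<N. p i \<xi> * q i \<eta> * r i \<tau>) = (\<lambda>\<xi> \<eta> \<tau>. \<Sum>i<N. p i \<xi> * q i \<eta> * deriv (r i) \<tau>)"
  unfolding d_xi_def d_eta_def d_tau_def
proof -
  show "(\<lambda>\<xi> \<eta> \<tau>. deriv (\<lambda>u. \<Sum>i<N. p i u * q i \<eta> * r i \<tau>) \<xi>) = (\<lambda>\<xi> \<eta> \<tau>. \<Sum>i<N. deriv (p i) \<xi> * q i \<eta> * r i \<tau>)"
    by (intro ext DERIV_imp_deriv DERIV_sum DERIV_cmult_right Pspace_has_deriv[of _ a]) (use assms in simp)
  show "(\<lambda>\<xi> \<eta> \<tau>. deriv (\<lambda>v. \<Sum>i<N. p i \<xi> * q i v * r i \<tau>) \<eta>) = (\<lambda>\<xi> \<eta> \<tau>. \<Sum>i<N. p i \<xi> * deriv (q i) \<eta> * r i \<tau>)"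
    by (intro ext DERIV_imp_deriv DERIV_sum DERIV_cmult_right DERIV_cmult Pspace_has_deriv[of _ a]) (use assms in simp)
  show "(\<lambda>\<xi> \<eta> \<tau>. deriv (\<lambda>s. \<Sum>i<N. p i \<xi> * q i \<eta> * r i s) \<tau>) = (\<lambda>\<xi> \<eta> \<tau>. \<Sum>i<N. p i \<xi> * q i \<eta> * deriv (r i) \<tau>)"
    by (intro ext DERIV_imp_deriv DERIV_sum DERIV_cmult Pspace_has_deriv[of _ b]) (use assms in simp)
qed

text \<open>
  The degree in the differentiated variable is not lowered: the bounds \<open>2l\<close> and \<open>2n\<close> for products of
  two partial derivatives already come out of this coarse version.
\<close>
lemma QPspace_partials:
  assumes "f \<in> QPspace a b"
  shows "d_xi f \<in> QPspace a b" "d_eta f \<in> QPspace a b" "d_tau f \<in> QPspace a b"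
proof -
  obtain N :: nat and p q r where f: "\<forall>i<N. p i \<in> Pspace a \<and> q i \<in> Pspace a \<and> r i \<in> Pspace b"
    "f = (\<lambda>\<xi> \<eta> \<tau>. \<Sum>i<N. p i \<xi> * q i \<eta> * r i \<tau>)"
    using assms by (rule QPspaceE) blast
  have "(\<lambda>\<xi> \<eta> \<tau>. \<Sum>i<N. deriv (p i) \<xi> * q i \<eta> * r i \<tau>) \<in> QPspace a b" "(\<lambda>\<xi> \<eta> \<tau>. \<Sum>i<N. p i \<xi> * deriv (q i) \<eta> * r i \<tau>) \<in> QPspace a b" "(\<lambda>\<xi> \<eta> \<tau>. \<Sum>i<N. p i \<xi> * q i \<eta> * deriv (r i) \<tau>) \<in> QPspace a b"
    by (rule QPspace_sum; rule QPspace_tensor; use f(1) in \<open>simp add: Pspace_deriv\<close>)+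
  then show "d_xi f \<in> QPspace a b" "d_eta f \<in> QPspace a b" "d_tau f \<in> QPspace a b"
    by (simp_all only: f(2) partials_tensor_sum[OF f(1)])
qed

lemma QPspace_partials_commute:
  assumes "f \<in> QPspace a b"
  shows "d_eta (d_xi f) = d_xi (d_eta f)" "d_tau (d_xi f) = d_xi (d_tau f)"
    "d_tau (d_eta f) = d_eta (d_tau f)"
proof -
  obtain N :: nat and p q r where f: "\<forall>i<N. p i \<in> Pspace a \<and> q i \<in> Pspace a \<and> r i \<in> Pspace b"
    "f = (\<lambda>\<xi> \<eta> \<tau>. \<Sum>i<N. p i \<xi> * q i \<eta> * r i \<tau>)"
    using assms by (rule QPspaceE) blast
  have derivs: "\<forall>i<N. deriv (p i) \<in> Pspace a \<and> q i \<in> Pspace a \<and> r i \<in> Pspace b"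
    "\<forall>i<N. p i \<in> Pspace a \<and> deriv (q i) \<in> Pspace a \<and> r i \<in> Pspace b"
    "\<forall>i<N. p i \<in> Pspace a \<and> q i \<in> Pspace a \<and> deriv (r i) \<in> Pspace b"
    using f(1) by (simp_all add: Pspace_deriv)
  show "d_eta (d_xi f) = d_xi (d_eta f)" "d_tau (d_xi f) = d_xi (d_tau f)"
    "d_tau (d_eta f) = d_eta (d_tau f)"
    by (simp_all only: f(2) partials_tensor_sum[OF f(1)] derivs[THEN partials_tensor_sum(1)]
        derivs[THEN partials_tensor_sum(2)] derivs[THEN partials_tensor_sum(3)])
qed

section \<open>Nodal differentiation\<close>

text \<open>
  The weight \<open>W\<close> is a basis function or one of its partial derivatives, evaluated at a fixed point;
  \<open>F\<close> enters through its values at the solution points only.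
\<close>
definition nodal_sum :: "nat \<Rightarrow> nat \<Rightarrow> (real \<times> real \<times> real \<Rightarrow> real) \<Rightarrow> (real \<Rightarrow> real \<Rightarrow> real \<Rightarrow> real) \<Rightarrow> real" where
  "nodal_sum a b W F = (\<Sum>(p, q, s)\<in>solution_points a b. W (p, q, s) * F p q s)"

abbreviation nodes :: "nat \<Rightarrow> real set" where
  "nodes a \<equiv> GL_points (a + 1)"

lemma interpolant_GL_poly: "degree p \<le> a \<Longrightarrow> interpolant (nodes a) (poly p) = p"
  by (simp add: interpolant_poly finite_GL_points card_GL_points)

lemma interpolant_GL_monomial: "d \<le> a \<Longrightarrow> interpolant (nodes a) (\<lambda>u. u ^ d) = monom 1 d"
  by (intro interpolant_unique)
    (simp_all add: finite_GL_points card_GL_points degree_monom_eq poly_monom del: add_Suc_right)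

lemma interpolant_GL_const: "interpolant (nodes a) (\<lambda>u. c) = [:c:]"
  by (intro interpolant_unique) (simp_all add: finite_GL_points card_GL_points)

lemma pderiv_interpolant:
  "poly (pderiv (interpolant S f)) z = (\<Sum>q\<in>S. f q * poly (pderiv (lagrange_poly S q)) z)"
proof -
  have "pderiv (interpolant S f) = (\<Sum>q\<in>S. smult (f q) (pderiv (lagrange_poly S q)))"
    using higher_pderiv_sum[of 1 "\<lambda>q. smult (f q) (lagrange_poly S q)" S]
    by (simp add: interpolant_def pderiv_smult)
  then show ?thesis
    by (simp add: poly_sum)
qed

lemma partials_basis:
  "d_xi (basis a b (p, q, s)) \<xi> \<eta> \<tau> =
    poly (pderiv (lagrange_poly (nodes a) p)) \<xi> * lagrange (nodes a) q \<eta> * lagrange (nodes b) s \<tau>"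
  "d_eta (basis a b (p, q, s)) \<xi> \<eta> \<tau> =
    lagrange (nodes a) p \<xi> * poly (pderiv (lagrange_poly (nodes a) q)) \<eta> * lagrange (nodes b) s \<tau>"
  "d_tau (basis a b (p, q, s)) \<xi> \<eta> \<tau> =
    lagrange (nodes a) p \<xi> * lagrange (nodes a) q \<eta> * poly (pderiv (lagrange_poly (nodes b) s)) \<tau>"
  unfolding d_xi_def d_eta_def d_tau_def basis_def lagrange_eq_poly prod.case
  by (rule DERIV_imp_deriv, intro DERIV_cmult_right DERIV_cmult poly_DERIV)+

lemma nodal_sum_product_weight:
  assumes "\<And>p q s. W (p, q, s) = u p * v q * w s"
  shows "nodal_sum a b W (\<lambda>p q s. f p * g q * h s) =
    (\<Sum>p\<in>nodes a. f p * u p) * (\<Sum>q\<in>nodes a. g q * v q) *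
    (\<Sum>s\<in>nodes b. h s * w s)"
proof -
  have "nodal_sum a b W (\<lambda>p q s. f p * g q * h s) =
    (\<Sum>p\<in>nodes a. \<Sum>q\<in>nodes a. \<Sum>s\<in>nodes b.
      (f p * u p) * ((g q * v q) * (h s * w s)))"
    unfolding nodal_sum_def solution_points_def
    by (simp add: assms mult_ac flip: sum.cartesian_product)
  also have "\<dots> = (\<Sum>p\<in>nodes a. f p * u p) * ((\<Sum>q\<in>nodes a. g q * v q) *
    (\<Sum>s\<in>nodes b. h s * w s))"
    by (simp only: sum_distrib_left[symmetric] sum_distrib_right[symmetric])
  finally show ?thesis
    by (simp only: mult.assoc)
qed

text \<open>
  Sums over the tensor-product grid factor over the directions. This reduces every nodal derivative
  to univariate interpolants.
\<close>
lemma nodal_sum_tensor: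
  "nodal_sum a b (\<lambda>j. basis a b j \<xi> \<eta> \<tau>) (\<lambda>p q s. f p * g q * h s) =
     poly (interpolant (nodes a) f) \<xi> * poly (interpolant (nodes a) g) \<eta> *
     poly (interpolant (nodes b) h) \<tau>"
  "nodal_sum a b (\<lambda>j. d_xi (basis a b j) \<xi> \<eta> \<tau>) (\<lambda>p q s. f p * g q * h s) =
     poly (pderiv (interpolant (nodes a) f)) \<xi> * poly (interpolant (nodes a) g) \<eta> *
     poly (interpolant (nodes b) h) \<tau>"
  "nodal_sum a b (\<lambda>j. d_eta (basis a b j) \<xi> \<eta> \<tau>) (\<lambda>p q s. f p * g q * h s) =
     poly (interpolant (nodes a) f) \<xi> * poly (pderiv (interpolant (nodes a) g)) \<eta> *
     poly (interpolant (nodes b) h) \<tau>"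
  "nodal_sum a b (\<lambda>j. d_tau (basis a b j) \<xi> \<eta> \<tau>) (\<lambda>p q s. f p * g q * h s) =
     poly (interpolant (nodes a) f) \<xi> * poly (interpolant (nodes a) g) \<eta> *
     poly (pderiv (interpolant (nodes b) h)) \<tau>"
  unfolding poly_interpolant pderiv_interpolant
  by (rule nodal_sum_product_weight, (rule partials_basis | simp only: basis_def prod.case))+

lemma nodal_sum_add:
  "nodal_sum a b W (\<lambda>p q s. F p q s + G p q s) = nodal_sum a b W F + nodal_sum a b W G"
  by (simp add: nodal_sum_def split_def distrib_left sum.distrib)

lemma nodal_sum_sum:
  "nodal_sum a b W (\<lambda>p q s. \<Sum>i\<in>A. F i p q s) = (\<Sum>i\<in>A. nodal_sum a b W (F i))"
  unfolding nodal_sum_def split_def sum_distrib_left by (rule sum.swap)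

lemma nodal_sum_exact:
  assumes "F \<in> QPspace a b"
  shows "nodal_sum a b (\<lambda>j. basis a b j \<xi> \<eta> \<tau>) F = F \<xi> \<eta> \<tau>"
    "nodal_sum a b (\<lambda>j. d_xi (basis a b j) \<xi> \<eta> \<tau>) F = d_xi F \<xi> \<eta> \<tau>"
    "nodal_sum a b (\<lambda>j. d_eta (basis a b j) \<xi> \<eta> \<tau>) F = d_eta F \<xi> \<eta> \<tau>"
    "nodal_sum a b (\<lambda>j. d_tau (basis a b j) \<xi> \<eta> \<tau>) F = d_tau F \<xi> \<eta> \<tau>"
proof -
  obtain N :: nat and p q r where f: "\<forall>i<N. p i \<in> Pspace a \<and> q i \<in> Pspace a \<and> r i \<in> Pspace b"
    "F = (\<lambda>\<xi> \<eta> \<tau>. \<Sum>i<N. p i \<xi> * q i \<eta> * r i \<tau>)"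
    using assms by (rule QPspaceE) blast
  have exact: "poly (interpolant (nodes c) g) z = g z"
    "poly (pderiv (interpolant (nodes c) g)) z = deriv g z"
    if mem: "g \<in> Pspace c" for g c z
  proof -
    obtain P where "g = poly P" "degree P \<le> c"
      using mem by (rule PspaceE)
    then show "poly (interpolant (nodes c) g) z = g z"
      "poly (pderiv (interpolant (nodes c) g)) z = deriv g z"
      by (simp_all only: interpolant_GL_poly DERIV_imp_deriv[OF poly_DERIV])
  qed
  note defs = f(2) partials_tensor_sum[OF f(1)] nodal_sum_sum nodal_sum_tensor
  show "nodal_sum a b (\<lambda>j. basis a b j \<xi> \<eta> \<tau>) F = F \<xi> \<eta> \<tau>"
    unfolding defs by (rule sum.cong) (use f(1) in \<open>simp_all only: exact lessThan_iff\<close>)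
  show "nodal_sum a b (\<lambda>j. d_xi (basis a b j) \<xi> \<eta> \<tau>) F = d_xi F \<xi> \<eta> \<tau>"
    unfolding defs by (rule sum.cong) (use f(1) in \<open>simp_all only: exact lessThan_iff\<close>)
  show "nodal_sum a b (\<lambda>j. d_eta (basis a b j) \<xi> \<eta> \<tau>) F = d_eta F \<xi> \<eta> \<tau>"
    unfolding defs by (rule sum.cong) (use f(1) in \<open>simp_all only: exact lessThan_iff\<close>)
  show "nodal_sum a b (\<lambda>j. d_tau (basis a b j) \<xi> \<eta> \<tau>) F = d_tau F \<xi> \<eta> \<tau>"
    unfolding defs by (rule sum.cong) (use f(1) in \<open>simp_all only: exact lessThan_iff\<close>)
qed

lemma basis_in_QPspace:
  assumes "j \<in> solution_points a b"
  shows "basis a b j \<in> QPspace a b"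
proof -
  obtain p q s where j: "j = (p, q, s)" "p \<in> nodes a" "q \<in> nodes a" "s \<in> nodes b"
    using assms by (auto simp: solution_points_def)
  have "lagrange (nodes c) z \<in> Pspace c" if "z \<in> nodes c" for c z
    using degree_lagrange_poly[OF finite_GL_points that]
    by (simp only: lagrange_eq_poly card_GL_points) (simp add: PspaceI)
  then show ?thesis
    using j by (simp add: basis_def QPspace_tensor)
qed

text \<open>
  The combinations of basis functions are exactly \<open>QPspace a b\<close>, and \<open>\<xi>\<^sup>k \<tau>\<^sup>m\<close> lies in it only if both
  degrees fit.
\<close>
lemma represents_solutions_iff: "represents_solutions k m a b \<longleftrightarrow> k \<le> a \<and> m \<le> b"
proof
  assume rep: "represents_solutions k m a b"
  have degree_bound: "d \<le> c" if mem: "(\<lambda>u::real. u ^ d) \<in> Pspace c" for c d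
  proof -
    obtain P :: "real poly" where P: "(\<lambda>u. u ^ d) = poly P" "degree P \<le> c"
      using mem by (rule PspaceE)
    then have "poly (monom 1 d) = poly P"
      by (simp add: poly_monom fun_eq_iff)
    then have "P = monom 1 d"
      by (simp add: poly_eq_poly_eq_iff)
    then show ?thesis
      using P(2) by (simp add: degree_monom_eq)
  qed
  define Q :: "real \<Rightarrow> real \<Rightarrow> real \<Rightarrow> real" where "Q = (\<lambda>\<xi> \<eta> \<tau>. \<xi> ^ k * 1 * \<tau> ^ m)"
  have "Q \<in> QPspace k m"
    unfolding Q_def using Pspace_monomial[of _ _ 1] Pspace_monomial[of 0 _ 1]
    by (intro QPspace_tensor) simp_all
  then obtain c where "Q = (\<lambda>\<xi> \<eta> \<tau>. \<Sum>j\<in>solution_points a b. c j * basis a b j \<xi> \<eta> \<tau>)"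
    using rep unfolding represents_solutions_def by blast
  also have "\<dots> \<in> QPspace a b"
    by (intro QPspace_sum QPspace_cmult basis_in_QPspace)
  finally have "Q \<in> QPspace a b" .
  then show "k \<le> a \<and> m \<le> b"
    using QPspace_sections(1)[of Q a b 1 1] QPspace_sections(3)[of Q a b 1 1]
    by (simp add: Q_def degree_bound)
next
  assume le: "k \<le> a \<and> m \<le> b"
  show "represents_solutions k m a b"
    unfolding represents_solutions_def
  proof
    fix Q assume "Q \<in> QPspace k m"
    then have "Q \<in> QPspace a b"
      using le by (blast intro: QPspace_mono)
    then have "Q = (\<lambda>\<xi> \<eta> \<tau>. \<Sum>j\<in>solution_points a b. (\<lambda>(p, q, s). Q p q s) j * basis a b j \<xi> \<eta> \<tau>)"
      by (auto simp: fun_eq_iff nodal_sum_def split_def mult.commute simp flip: nodal_sum_exact(1)[of Q a b])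
    then show "\<exists>c. Q = (\<lambda>\<xi> \<eta> \<tau>. \<Sum>j\<in>solution_points a b. c j * basis a b j \<xi> \<eta> \<tau>)"
      by blast
  qed
qed

section \<open>Exactness for degrees at least \<open>2l\<close> and \<open>2n\<close>\<close>

text \<open>
  One component of the left-hand side of the discrete conservation law, for arbitrary fluxes in the
  order \<open>\<tau>\<close>, \<open>\<xi>\<close>, \<open>\<eta>\<close>.
\<close>
definition nodal_divergence ::
  "nat \<Rightarrow> nat \<Rightarrow> (real \<Rightarrow> real \<Rightarrow> real \<Rightarrow> real) \<Rightarrow> (real \<Rightarrow> real \<Rightarrow> real \<Rightarrow> real) \<Rightarrow>
    (real \<Rightarrow> real \<Rightarrow> real \<Rightarrow> real) \<Rightarrow> real \<Rightarrow> real \<Rightarrow> real \<Rightarrow> real" where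
  "nodal_divergence a b T X Y \<xi> \<eta> \<tau> =
     nodal_sum a b (\<lambda>j. d_tau (basis a b j) \<xi> \<eta> \<tau>) T +
     nodal_sum a b (\<lambda>j. d_xi (basis a b j) \<xi> \<eta> \<tau>) X +
     nodal_sum a b (\<lambda>j. d_eta (basis a b j) \<xi> \<eta> \<tau>) Y"

lemma discrete_GCL_iff:
  "discrete_GCL a b x y t \<longleftrightarrow>
    (\<forall>\<xi>\<in>{-1..1}. \<forall>\<eta>\<in>{-1..1}. \<forall>\<tau>\<in>{-1..1}. \<forall>c.
      nodal_divergence a b (\<lambda>p q s. metric_tau x y t p q s $ c) (\<lambda>p q s. metric_xi x y t p q s $ c)
        (\<lambda>p q s. metric_eta x y t p q s $ c) \<xi> \<eta> \<tau> = 0)"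
  by (simp add: discrete_GCL_def nodal_divergence_def nodal_sum_def vec_eq_iff split_def)

lemma nodal_divergence_exact:
  assumes "T \<in> QPspace a b" "X \<in> QPspace a b" "Y \<in> QPspace a b"
  shows "nodal_divergence a b T X Y \<xi> \<eta> \<tau> = d_tau T \<xi> \<eta> \<tau> + d_xi X \<xi> \<eta> \<tau> + d_eta Y \<xi> \<eta> \<tau>"
  using assms by (simp add: nodal_divergence_def nodal_sum_exact)

text \<open>
  The metrics lie in \<open>QPspace (2 * l) (2 * n)\<close>, so their nodal divergence is the true divergence, and
  this vanishes because each product \<open>f\<^sub>u\<^sub>v g\<^sub>w\<close>, \<open>{u, v, w} = {\<tau>, \<xi>, \<eta>}\<close>, that the product rule produces
  comes twice with opposite signs.
\<close>
lemma exact_metrics_discrete_GCL: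
  assumes x: "x \<in> QPspace l n" and y: "y \<in> QPspace l n" and t: "t \<in> Pspace n"
    and "2 * l \<le> a" "2 * n \<le> b"
  shows "discrete_GCL a b x y t"
proof -
  have product: "(\<lambda>\<xi> \<eta> \<tau>. c * (f \<xi> \<eta> \<tau> * g \<xi> \<eta> \<tau>)) \<in> QPspace a b"
    if "f \<in> QPspace l n" "g \<in> QPspace l n" for f g c
    using QPspace_cmult[OF QPspace_mono[OF QPspace_mult[OF that]], of a b c] assms(4,5)
    by simp
  have product1: "(\<lambda>\<xi> \<eta> \<tau>. f \<xi> \<eta> \<tau> * g \<xi> \<eta> \<tau>) \<in> QPspace a b"
    "(\<lambda>\<xi> \<eta> \<tau>. - f \<xi> \<eta> \<tau> * g \<xi> \<eta> \<tau>) \<in> QPspace a b"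
    if "f \<in> QPspace l n" "g \<in> QPspace l n" for f g
    using product[OF that, of 1] product[OF that, of "-1"] by simp_all
  have diff: "(\<lambda>\<xi> \<eta> \<tau>. f \<xi> \<eta> \<tau> * g \<xi> \<eta> \<tau> - h \<xi> \<eta> \<tau> * k \<xi> \<eta> \<tau>) \<in> QPspace a b"
    if "f \<in> QPspace l n" "g \<in> QPspace l n" "h \<in> QPspace l n" "k \<in> QPspace l n" for f g h k
    using QPspace_add[OF product[OF that(1,2), of 1] product[OF that(3,4), of "-1"]] by simp
  have t': "(\<lambda>\<xi> \<eta> \<tau>. deriv t \<tau>) \<in> QPspace l n"
    using QPspace_tensor[OF Pspace_monomial[of 0 l 1] Pspace_monomial[of 0 l 1] Pspace_deriv[OF t]]
    by simp
  note px = QPspace_partials[OF x] and py = QPspace_partials[OF y]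
  note D = px[THEN QPspace_has_partials(1)] px[THEN QPspace_has_partials(2)] px[THEN QPspace_has_partials(3)]
    py[THEN QPspace_has_partials(1)] py[THEN QPspace_has_partials(2)] py[THEN QPspace_has_partials(3)]
  note commute = QPspace_partials_commute[OF x] QPspace_partials_commute[OF y]
  have d1: "d_tau (\<lambda>\<xi> \<eta> \<tau>. d_xi x \<xi> \<eta> \<tau> * d_eta y \<xi> \<eta> \<tau> - d_eta x \<xi> \<eta> \<tau> * d_xi y \<xi> \<eta> \<tau>) \<xi> \<eta> \<tau> =
      d_tau (d_xi x) \<xi> \<eta> \<tau> * d_eta y \<xi> \<eta> \<tau> + d_tau (d_eta y) \<xi> \<eta> \<tau> * d_xi x \<xi> \<eta> \<tau>
      - (d_tau (d_eta x) \<xi> \<eta> \<tau> * d_xi y \<xi> \<eta> \<tau> + d_tau (d_xi y) \<xi> \<eta> \<tau> * d_eta x \<xi> \<eta> \<tau>)"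
    for \<xi> \<eta> \<tau>
    by (subst d_tau_def, rule DERIV_imp_deriv) (intro DERIV_diff DERIV_mult D)
  have d2: "d_xi (\<lambda>\<xi> \<eta> \<tau>. d_tau y \<xi> \<eta> \<tau> * d_eta x \<xi> \<eta> \<tau> - d_tau x \<xi> \<eta> \<tau> * d_eta y \<xi> \<eta> \<tau>) \<xi> \<eta> \<tau> =
      d_xi (d_tau y) \<xi> \<eta> \<tau> * d_eta x \<xi> \<eta> \<tau> + d_xi (d_eta x) \<xi> \<eta> \<tau> * d_tau y \<xi> \<eta> \<tau>
      - (d_xi (d_tau x) \<xi> \<eta> \<tau> * d_eta y \<xi> \<eta> \<tau> + d_xi (d_eta y) \<xi> \<eta> \<tau> * d_tau x \<xi> \<eta> \<tau>)"
    for \<xi> \<eta> \<tau>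
    by (subst d_xi_def, rule DERIV_imp_deriv) (intro DERIV_diff DERIV_mult D)
  have d3: "d_eta (\<lambda>\<xi> \<eta> \<tau>. d_tau x \<xi> \<eta> \<tau> * d_xi y \<xi> \<eta> \<tau> - d_tau y \<xi> \<eta> \<tau> * d_xi x \<xi> \<eta> \<tau>) \<xi> \<eta> \<tau> =
      d_eta (d_tau x) \<xi> \<eta> \<tau> * d_xi y \<xi> \<eta> \<tau> + d_eta (d_xi y) \<xi> \<eta> \<tau> * d_tau x \<xi> \<eta> \<tau>
      - (d_eta (d_tau y) \<xi> \<eta> \<tau> * d_xi x \<xi> \<eta> \<tau> + d_eta (d_xi x) \<xi> \<eta> \<tau> * d_tau y \<xi> \<eta> \<tau>)"
    for \<xi> \<eta> \<tau>
    by (subst d_eta_def, rule DERIV_imp_deriv) (intro DERIV_diff DERIV_mult D)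
  have d4: "d_xi (\<lambda>\<xi> \<eta> \<tau>. c \<tau> * d_eta z \<xi> \<eta> \<tau>) \<xi> \<eta> \<tau> = c \<tau> * d_xi (d_eta z) \<xi> \<eta> \<tau>"
    if "z \<in> QPspace l n" for z c \<xi> \<eta> \<tau>
    by (subst d_xi_def, rule DERIV_imp_deriv, rule DERIV_cmult)
      (rule QPspace_has_partials(1)[OF QPspace_partials(2)[OF that]])
  have d5: "d_eta (\<lambda>\<xi> \<eta> \<tau>. c \<tau> * d_xi z \<xi> \<eta> \<tau>) \<xi> \<eta> \<tau> = c \<tau> * d_eta (d_xi z) \<xi> \<eta> \<tau>"
    if "z \<in> QPspace l n" for z c \<xi> \<eta> \<tau>
    by (subst d_eta_def, rule DERIV_imp_deriv, rule DERIV_cmult)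
      (rule QPspace_has_partials(2)[OF QPspace_partials(1)[OF that]])
  have d0: "d_tau (\<lambda>\<xi> \<eta> \<tau>. 0) \<xi> \<eta> \<tau> = 0" for \<xi> \<eta> \<tau>
    by (simp add: d_tau_def)
  have swap: "- u * v + w * z = w * z - u * v" for u v w z :: real
    by simp
  have "nodal_divergence a b (\<lambda>p q s. metric_tau x y t p q s $ c) (\<lambda>p q s. metric_xi x y t p q s $ c)
      (\<lambda>p q s. metric_eta x y t p q s $ c) \<xi> \<eta> \<tau> = 0" for c \<xi> \<eta> \<tau>
  proof -
    consider "c = 1" | "c = 2" | "c = 3"
      using exhaust_3 by blast
    then show ?thesis
    proof cases
      case 1
      show ?thesis
        unfolding 1 metric_tau_def metric_xi_def metric_eta_def vector_3 swap
        by (subst nodal_divergence_exact; (intro diff px py)?)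
          (simp only: d1 d2 d3 commute)
    next
      case 2
      show ?thesis
        unfolding 2 metric_tau_def metric_xi_def metric_eta_def vector_3
        by (subst nodal_divergence_exact; (intro QPspace_zero product1 t' px py)?)
          (simp add: d0 d4[OF y] d5[OF y, of "\<lambda>s. - deriv t s", simplified] commute)
    next
      case 3
      show ?thesis
        unfolding 3 metric_tau_def metric_xi_def metric_eta_def vector_3
        by (subst nodal_divergence_exact; (intro QPspace_zero product1 t' px py)?)
          (simp add: d0 d5[OF x] d4[OF x, of "\<lambda>s. - deriv t s", simplified] commute)
    qed
  qed
  then show ?thesis
    by (simp add: discrete_GCL_iff)
qed

section \<open>Obstructions for smaller degrees\<close>

text \<open>
  The first components of the metrics are \<open>A B\<close>, \<open>-\<xi> A' B\<close> and \<open>-\<eta> A B'\<close>. At \<open>\<xi> = \<eta> = 0\<close> the two spatial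
  derivatives share the factor \<open>(I \<xi>)'\<close>, which is \<open>1\<close> if \<open>a \<ge> 1\<close> and \<open>0\<close> if \<open>a = 0\<close>; keeping it as a factor
  covers both situations.
\<close>
lemma separable_element_GCL:
  fixes A B :: "real poly"
  assumes deg: "degree A \<le> n" "degree B \<le> n" "1 \<le> l" "1 \<le> n"
    and nonzero: "\<And>z. z \<in> {-1..1} \<Longrightarrow> poly A z \<noteq> 0 \<and> poly B z \<noteq> 0"
    and GCL: "\<And>x y t. space_time_element l n x y t \<Longrightarrow> discrete_GCL a b x y t"
    and \<tau>: "\<tau> \<in> {-1..1}"
  shows "poly (pderiv (interpolant (nodes b) (poly (A * B)))) \<tau> =
    poly (pderiv (interpolant (nodes a) (\<lambda>u. u))) 0 * poly (interpolant (nodes b) (poly (pderiv (A * B)))) \<tau>"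
proof -
  define x where "x = (\<lambda>(\<xi>::real) (\<eta>::real) (\<tau>::real). \<xi> * 1 * poly A \<tau>)"
  define y where "y = (\<lambda>(\<xi>::real) (\<eta>::real) (\<tau>::real). 1 * \<eta> * poly B \<tau>)"
  define t :: "real \<Rightarrow> real" where "t = (\<lambda>\<tau>. \<tau>)"
  define U V W where "U = pderiv A * B" and "V = A * pderiv B" and "W = A * B"
  have id: "(\<lambda>u. u) \<in> Pspace c" if "1 \<le> c" for c
    using Pspace_monomial[OF that, of 1] by simp
  have one: "(\<lambda>u. 1) \<in> Pspace c" for c
    using Pspace_monomial[of 0 c 1] by simp
  have dx: "d_xi x = (\<lambda>\<xi> \<eta> \<tau>. poly A \<tau>)" "d_eta x = (\<lambda>\<xi> \<eta> \<tau>. 0)"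
    "d_tau x = (\<lambda>\<xi> \<eta> \<tau>. \<xi> * poly (pderiv A) \<tau>)"
    unfolding x_def d_xi_def d_eta_def d_tau_def
    by (intro ext DERIV_imp_deriv; auto intro!: derivative_eq_intros)+
  have dy: "d_xi y = (\<lambda>\<xi> \<eta> \<tau>. 0)" "d_eta y = (\<lambda>\<xi> \<eta> \<tau>. poly B \<tau>)"
    "d_tau y = (\<lambda>\<xi> \<eta> \<tau>. \<eta> * poly (pderiv B) \<tau>)"
    unfolding y_def d_xi_def d_eta_def d_tau_def
    by (intro ext DERIV_imp_deriv; auto intro!: derivative_eq_intros)+
  have "space_time_element l n x y t"
    unfolding space_time_element_def
  proof (intro conjI ballI)
    show "x \<in> QPspace l n" "y \<in> QPspace l n"
      unfolding x_def y_def by (intro QPspace_tensor id one PspaceI deg)+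
    show "t \<in> Pspace n"
      unfolding t_def by (intro id deg)
    fix \<xi> \<eta> \<tau> :: real assume "\<tau> \<in> {-1..1}"
    then show "invertible (jacobian x y t \<xi> \<eta> \<tau>)"
      using nonzero by (simp add: invertible_det_nz det_jacobian dx dy t_def)
  qed
  then have "discrete_GCL a b x y t"
    by (rule GCL)
  then have "nodal_divergence a b (\<lambda>p q s. metric_tau x y t p q s $ 1) (\<lambda>p q s. metric_xi x y t p q s $ 1)
        (\<lambda>p q s. metric_eta x y t p q s $ 1) 0 0 \<tau> = 0"
    using \<tau> by (simp add: discrete_GCL_iff)
  moreover have "(\<lambda>p q s. metric_tau x y t p q s $ 1) = (\<lambda>p q s. 1 * 1 * poly W s)"
    "(\<lambda>p q s. metric_xi x y t p q s $ 1) = (\<lambda>p q s. p * 1 * (- 1 * poly U s))"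
    "(\<lambda>p q s. metric_eta x y t p q s $ 1) = (\<lambda>p q s. 1 * q * (- 1 * poly V s))"
    by (simp_all add: metric_tau_def metric_xi_def metric_eta_def dx dy U_def V_def W_def mult_ac)
  ultimately have "nodal_divergence a b (\<lambda>p q s. 1 * 1 * poly W s) (\<lambda>p q s. p * 1 * (- 1 * poly U s))
      (\<lambda>p q s. 1 * q * (- 1 * poly V s)) 0 0 \<tau> = 0"
    by simp
  then have "poly (pderiv (interpolant (nodes b) (poly W))) \<tau> =
    poly (pderiv (interpolant (nodes a) (\<lambda>u. u))) 0 *
    (poly (interpolant (nodes b) (poly U)) \<tau> + poly (interpolant (nodes b) (poly V)) \<tau>)"
    by (simp only: nodal_divergence_def nodal_sum_tensor interpolant_GL_const interpolant_cmult)
      (simp add: algebra_simps)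
  also have "poly (interpolant (nodes b) (poly U)) \<tau> + poly (interpolant (nodes b) (poly V)) \<tau>
    = poly (interpolant (nodes b) (poly (U + V))) \<tau>"
    by (simp only: poly_fun_arith(1) interpolant_add poly_add)
  also have "U + V = pderiv W"
    by (simp add: U_def V_def W_def pderiv_mult algebra_simps)
  finally show ?thesis
    by (simp only: W_def)
qed

text \<open>
  The first components of the metrics are
  \<open>c\<^sup>2 + c \<tau> \<eta> G' - \<tau>\<^sup>2 G H'\<close>, \<open>-c \<eta> G + \<tau> G H\<close> and \<open>\<tau> \<eta> (G H' - G' H) - c H\<close>.
  Interpolation is exact for their dependence on \<open>\<eta>\<close> and \<open>\<tau>\<close> once \<open>a \<ge> 1\<close> and \<open>b \<ge> 2\<close>, so only interpolation
  in \<open>\<xi>\<close> remains. At \<open>\<eta> = 0\<close>, \<open>\<tau> = 1\<close> the law reads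
  \<open>-2 I(G H') + (I(G H))' + I(G H' - G' H) = 0\<close>, which is \<open>(I(G H))' = I((G H)')\<close>.
  The constant \<open>c\<close> is there to keep the element non-singular.
\<close>
lemma sheared_element_GCL:
  fixes G H :: "real poly"
  assumes deg: "degree G \<le> l" "degree H \<le> l" "1 \<le> l" "1 \<le> n"
    and nonzero: "\<And>\<xi> \<eta> \<tau>. \<xi> \<in> {-1..1} \<Longrightarrow> \<eta> \<in> {-1..1} \<Longrightarrow> \<tau> \<in> {-1..1} \<Longrightarrow>
      c\<^sup>2 + c * \<tau> * \<eta> * poly (pderiv G) \<xi> - \<tau>\<^sup>2 * poly (G * pderiv H) \<xi> \<noteq> 0"
    and GCL: "\<And>x y t. space_time_element l n x y t \<Longrightarrow> discrete_GCL a b x y t"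
    and "1 \<le> a" "2 \<le> b" and \<xi>: "\<xi> \<in> {-1..1}"
  shows "poly (commutation_defect (nodes a) (G * H)) \<xi> = 0"
proof -
  define x where "x = (\<lambda>(\<xi>::real) (\<eta>::real) (\<tau>::real). c * \<xi> * 1 * 1 + poly G \<xi> * \<eta> * \<tau>)"
  define y where "y = (\<lambda>(\<xi>::real) (\<eta>::real) (\<tau>::real). 1 * (c * \<eta>) * 1 + poly H \<xi> * 1 * \<tau>)"
  define t :: "real \<Rightarrow> real" where "t = (\<lambda>\<tau>. \<tau>)"
  define U V W where "U = G * pderiv H" and "V = pderiv G * H" and "W = G * H"
  have lin: "(\<lambda>u. k * u) \<in> Pspace d" if "1 \<le> d" for d k
    using Pspace_monomial[OF that, of k] by simp
  have id: "(\<lambda>u. u) \<in> Pspace d" if "1 \<le> d" for d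
    using lin[OF that, of 1] by simp
  have one: "(\<lambda>u. 1) \<in> Pspace d" for d
    using Pspace_monomial[of 0 d 1] by simp
  have dx: "d_xi x = (\<lambda>\<xi> \<eta> \<tau>. c + poly (pderiv G) \<xi> * \<eta> * \<tau>)" "d_eta x = (\<lambda>\<xi> \<eta> \<tau>. poly G \<xi> * \<tau>)"
    "d_tau x = (\<lambda>\<xi> \<eta> \<tau>. poly G \<xi> * \<eta>)"
    unfolding x_def d_xi_def d_eta_def d_tau_def
    by (intro ext DERIV_imp_deriv; auto intro!: derivative_eq_intros)+
  have dy: "d_xi y = (\<lambda>\<xi> \<eta> \<tau>. poly (pderiv H) \<xi> * \<tau>)" "d_eta y = (\<lambda>\<xi> \<eta> \<tau>. c)"
    "d_tau y = (\<lambda>\<xi> \<eta> \<tau>. poly H \<xi>)"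
    unfolding y_def d_xi_def d_eta_def d_tau_def
    by (intro ext DERIV_imp_deriv; auto intro!: derivative_eq_intros)+
  have "space_time_element l n x y t"
    unfolding space_time_element_def
  proof (intro conjI ballI)
    show "x \<in> QPspace l n" "y \<in> QPspace l n"
      unfolding x_def y_def by (intro QPspace_add QPspace_tensor lin id one PspaceI deg)+
    show "t \<in> Pspace n"
      unfolding t_def by (intro id deg)
    fix \<xi> \<eta> \<tau> :: real assume "\<xi> \<in> {-1..1}" "\<eta> \<in> {-1..1}" "\<tau> \<in> {-1..1}"
    then show "invertible (jacobian x y t \<xi> \<eta> \<tau>)"
      using nonzero[of \<xi> \<eta> \<tau>]
      by (simp add: invertible_det_nz det_jacobian dx dy t_def algebra_simps power2_eq_square)
  qed
  then have "discrete_GCL a b x y t"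
    by (rule GCL)
  then have "nodal_divergence a b (\<lambda>p q s. metric_tau x y t p q s $ 1) (\<lambda>p q s. metric_xi x y t p q s $ 1)
        (\<lambda>p q s. metric_eta x y t p q s $ 1) \<xi> 0 1 = 0"
    using \<xi> by (simp add: discrete_GCL_iff)
  moreover have "(\<lambda>p q s. metric_tau x y t p q s $ 1) =
      (\<lambda>p q s. c\<^sup>2 * 1 * 1 + ((c * poly (pderiv G) p) * q * s + (- 1 * poly U p) * 1 * s ^ 2))"
    "(\<lambda>p q s. metric_xi x y t p q s $ 1) =
      (\<lambda>p q s. (- c * poly G p) * q * 1 + poly W p * 1 * s)"
    "(\<lambda>p q s. metric_eta x y t p q s $ 1) =
      (\<lambda>p q s. (poly U p + - 1 * poly V p) * q * s + (- c * poly H p) * 1 * 1)"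
    by (simp_all add: metric_tau_def metric_xi_def metric_eta_def dx dy fun_eq_iff U_def V_def W_def
        algebra_simps power2_eq_square)
  ultimately have
    "nodal_divergence a b
      (\<lambda>p q s. c\<^sup>2 * 1 * 1 + ((c * poly (pderiv G) p) * q * s + (- 1 * poly U p) * 1 * s ^ 2))
      (\<lambda>p q s. (- c * poly G p) * q * 1 + poly W p * 1 * s)
      (\<lambda>p q s. (poly U p + - 1 * poly V p) * q * s + (- c * poly H p) * 1 * 1) \<xi> 0 1 = 0"
    by simp
  moreover have "interpolant (nodes a) (\<lambda>u. u) = monom 1 1" "interpolant (nodes b) (\<lambda>u. u) = monom 1 1"
    using interpolant_GL_monomial[of 1 a] interpolant_GL_monomial[of 1 b] assms(7,8)
    by (simp_all add: power_one_right)
  ultimately have "poly (pderiv (interpolant (nodes a) (poly W))) \<xi> =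
     poly (interpolant (nodes a) (poly U)) \<xi> + poly (interpolant (nodes a) (poly V)) \<xi>"
    by (simp only: nodal_divergence_def nodal_sum_add nodal_sum_tensor interpolant_GL_const
        interpolant_cmult interpolant_add interpolant_GL_monomial[OF \<open>2 \<le> b\<close>])
      (simp add: poly_monom pderiv_monom)
  also have "\<dots> = poly (interpolant (nodes a) (poly (U + V))) \<xi>"
    by (simp only: poly_fun_arith(1) interpolant_add poly_add)
  also have "U + V = pderiv W"
    by (simp add: U_def V_def W_def pderiv_mult algebra_simps)
  finally show ?thesis
    by (simp only: commutation_defect_def W_def[symmetric] poly_diff diff_self)
qed

lemma poly_zero_on_interval:
  fixes p :: "real poly"
  assumes "\<And>z. z \<in> {-1..1} \<Longrightarrow> poly p z = 0"
  shows "p = 0"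
proof (rule ccontr)
  assume "p \<noteq> 0"
  then have "finite {z. poly p z = 0}"
    by (rule poly_roots_finite)
  then have "finite {-1..1::real}"
    by (rule finite_subset[rotated]) (use assms in auto)
  then show False
    using infinite_Icc[of "-1::real" 1] by simp
qed

text \<open>
  If \<open>a + 1 \<le> 2d\<close>, then every exponent up to the number \<open>a + 1\<close> of nodes splits as \<open>i + j\<close> with \<open>i, j \<le> d\<close>,
  and no monomial is left to carry a nonzero defect.
\<close>
lemma defect_free_degree_bound:
  assumes "\<And>i j. i \<le> d \<Longrightarrow> j \<le> d \<Longrightarrow> commutation_defect (nodes a) (monom 1 (i + j)) = 0"
  shows "2 * d \<le> a"
proof (rule ccontr)
  assume "\<not> 2 * d \<le> a"
  obtain e where e: "e \<le> a + 1" "commutation_defect (nodes a) (monom 1 e) \<noteq> 0"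
    using commutation_defect_obstruction[of "nodes a"] finite_GL_points[of "a + 1"] card_GL_points[of "a + 1"]
    by fastforce
  have "min e d + (e - min e d) = e" "min e d \<le> d" "e - min e d \<le> d"
    using e(1) \<open>\<not> 2 * d \<le> a\<close> by auto
  then show False
    using assms e(2) by metis
qed

text \<open>
  With \<open>a = 0\<close> nodal derivatives in \<open>\<xi>\<close> and \<open>\<eta>\<close> vanish identically, so the law would make the interpolated
  \<open>|J| \<tau>\<^sub>t\<close> constant in time; an element stretched linearly in time contradicts this if \<open>b \<ge> 1\<close>.
  For \<open>a = b = 0\<close> all nodal derivatives vanish and the discrete law says nothing.
\<close>
lemma GCL_imp_spatial_degree_positive:
  assumes "1 \<le> l" "1 \<le> n" "(a, b) \<noteq> (0, 0)"
    and GCL: "\<And>x y t. space_time_element l n x y t \<Longrightarrow> discrete_GCL a b x y t"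
  shows "1 \<le> a"
proof (rule ccontr)
  assume "\<not> 1 \<le> a"
  then have a: "a = 0" and b: "1 \<le> b"
    using assms(3) by auto
  have "degree (interpolant (nodes a) (\<lambda>u. u)) < card (nodes a)"
    using card_GL_points[of "a + 1"] by (intro degree_interpolant finite_GL_points) auto
  then have "pderiv (interpolant (nodes a) (\<lambda>u. u)) = 0"
    by (simp add: card_GL_points a pderiv_eq_0_iff)
  then have "poly (pderiv (interpolant (nodes b) (poly ([:2, 1:] * 1)))) 0 = 0"
    using separable_element_GCL[of "[:2, 1:]" n 1 l a b 0] assms by force
  then show False
    using interpolant_GL_poly[of "[:2, 1:]" b] b by (simp add: pderiv_pCons)
qed

text \<open>
  Separable elements with \<open>A = 2 + \<tau>\<^sup>i\<close>, \<open>B = 2 + \<tau>\<^sup>j\<close>, where the \<open>2\<close> keeps both factors positive on the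
  reference interval. Expanding \<open>A B\<close> and removing the defects of \<open>1\<close>, \<open>\<tau>\<^sup>i\<close>, \<open>\<tau>\<^sup>j\<close> leaves that of
  \<open>\<tau>\<^sup>i\<^sup>+\<^sup>j\<close>.
\<close>
lemma GCL_imp_temporal_degree:
  assumes "1 \<le> l" "1 \<le> n" "1 \<le> a"
    and GCL: "\<And>x y t. space_time_element l n x y t \<Longrightarrow> discrete_GCL a b x y t"
  shows "2 * n \<le> b"
proof (rule defect_free_degree_bound)
  define A :: "nat \<Rightarrow> real poly" where "A i = [:2:] + monom 1 i" for i
  have slope: "poly (pderiv (interpolant (nodes a) (\<lambda>u. u))) 0 = 1"
    using interpolant_GL_monomial[OF \<open>1 \<le> a\<close>] by (simp add: pderiv_monom poly_monom)
  have degA: "degree (A i) \<le> n" if "i \<le> n" for i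
    unfolding A_def using that by (intro degree_add_le) (simp_all add: degree_monom_eq)
  have posA: "poly (A i) z \<noteq> 0" if "z \<in> {-1..1}" for i z
  proof -
    have "\<bar>z ^ i\<bar> \<le> 1"
      using that by (simp add: power_abs power_le_one abs_le_iff)
    then show ?thesis
      by (simp add: A_def poly_monom)
  qed
  have product: "commutation_defect (nodes b) (A i * A j) = 0" if "i \<le> n" "j \<le> n" for i j
  proof (rule poly_zero_on_interval)
    fix z :: real assume z: "z \<in> {-1..1}"
    have "poly (pderiv (interpolant (nodes b) (poly (A i * A j)))) z =
        poly (pderiv (interpolant (nodes a) (\<lambda>u. u))) 0 *
        poly (interpolant (nodes b) (poly (pderiv (A i * A j)))) z"
    proof (rule separable_element_GCL[OF degA degA assms(1,2) _ GCL z])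
      show "i \<le> n" "j \<le> n"
        by (fact that)+
      show "poly (A i) u \<noteq> 0 \<and> poly (A j) u \<noteq> 0" if "u \<in> {-1..1}" for u
        using posA[OF that] by simp
    qed
    then show "poly (commutation_defect (nodes b) (A i * A j)) z = 0"
      by (simp only: slope commutation_defect_def poly_diff diff_self mult_1_left)
  qed
  have one: "commutation_defect (nodes b) (monom 1 0) = 0"
    by (intro commutation_defect_low_degree) (simp_all add: finite_GL_points card_GL_points degree_monom_eq)
  have expand: "A i * A j = smult 4 (monom 1 0) + smult 2 (monom 1 i) + smult 2 (monom 1 j) + monom 1 (i + j)" for i j
    by (simp add: A_def algebra_simps mult_monom monom_0)
  \<comment> \<open>The case \<open>j = 0\<close>, where \<open>B\<close> is the constant \<open>3\<close>.\<close>
  have single: "commutation_defect (nodes b) (monom 1 i) = 0" if "i \<le> n" for i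
  proof -
    have "smult 2 (commutation_defect (nodes b) (monom 1 i)) + commutation_defect (nodes b) (monom 1 i) = 0"
      using product[OF that, of 0]
      by (simp only: expand commutation_defect_add commutation_defect_smult one) simp
    then have "smult 3 (commutation_defect (nodes b) (monom 1 i)) = 0"
      using smult_add_left[of 2 1 "commutation_defect (nodes b) (monom 1 i)"] by simp
    then show ?thesis
      by simp
  qed
  show "commutation_defect (nodes b) (monom 1 (i + j)) = 0" if "i \<le> n" "j \<le> n" for i j
    using product[OF that]
    by (simp only: expand commutation_defect_add commutation_defect_smult one
        single[OF that(1)] single[OF that(2)]) simp
qed

text \<open>
  Sheared elements with \<open>G = \<xi>\<^sup>i\<close>, \<open>H = \<xi>\<^sup>j\<close>. As \<open>|G'|\<close> and \<open>|G H'|\<close> are at most \<open>l\<close> on the reference element,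
  the determinant is at least \<open>c\<^sup>2 - c l - l\<close>, which is positive for \<open>c = l + 2\<close>.
\<close>
lemma GCL_imp_spatial_degree:
  assumes "1 \<le> l" "1 \<le> n" "1 \<le> a" "2 \<le> b"
    and GCL: "\<And>x y t. space_time_element l n x y t \<Longrightarrow> discrete_GCL a b x y t"
  shows "2 * l \<le> a"
proof (rule defect_free_degree_bound)
  fix i j assume ij: "i \<le> l" "j \<le> l"
  define c where "c = real l + 2"
  have abs_power: "\<bar>z ^ i\<bar> \<le> 1" if "z \<in> {-1..1}" for z :: real and i
    using that by (simp add: power_abs power_le_one abs_le_iff)
  have abs_deriv: "\<bar>poly (pderiv (monom 1 i)) z\<bar> \<le> real l" if "z \<in> {-1..1}" "i \<le> l" for z :: real and i
    using mult_mono[of "real i" "real l" "\<bar>z ^ (i - 1)\<bar>" 1] abs_power[OF that(1)] that(2)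
    by (simp add: pderiv_monom poly_monom abs_mult)
  have prod_bound: "\<bar>u * v\<bar> \<le> r" if "\<bar>u\<bar> \<le> 1" "\<bar>v\<bar> \<le> r" for u v r :: real
    using mult_mono[OF that] by (simp add: abs_mult)
  have nonzero: "c\<^sup>2 + c * \<tau> * \<eta> * poly (pderiv (monom 1 i)) \<xi> - \<tau>\<^sup>2 * poly (monom 1 i * pderiv (monom 1 j)) \<xi> \<noteq> 0"
    if cube: "\<xi> \<in> {-1..1}" "\<eta> \<in> {-1..1}" "\<tau> \<in> {-1..1}" for \<xi> \<eta> \<tau>
  proof -
    have "\<bar>\<tau> * (\<eta> * poly (pderiv (monom 1 i)) \<xi>)\<bar> \<le> l"
      using cube by (intro prod_bound abs_deriv ij) auto
    then have "c * \<bar>\<tau> * (\<eta> * poly (pderiv (monom 1 i)) \<xi>)\<bar> \<le> c * l"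
      by (intro mult_left_mono) (simp_all add: c_def)
    then have 1: "\<bar>c * \<tau> * \<eta> * poly (pderiv (monom 1 i)) \<xi>\<bar> \<le> c * l"
      by (simp add: c_def abs_mult mult_ac)
    have 2: "\<bar>\<tau>\<^sup>2 * poly (monom 1 i * pderiv (monom 1 j)) \<xi>\<bar> \<le> l"
      unfolding poly_mult using cube
      by (intro prod_bound abs_power abs_deriv ij) (auto simp only: poly_monom mult_1_left abs_power)
    have "c\<^sup>2 = c * l + 2 * l + 4"
      by (simp add: c_def power2_eq_square algebra_simps)
    then show ?thesis
      using 1 2 by linarith
  qed
  have "commutation_defect (nodes a) (monom 1 i * monom 1 j) = 0"
  proof (rule poly_zero_on_interval)
    fix z :: real assume "z \<in> {-1..1}"
    then show "poly (commutation_defect (nodes a) (monom 1 i * monom 1 j)) z = 0"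
      using ij assms nonzero
      by (intro sheared_element_GCL[of "monom 1 i" l "monom 1 j" n c a b z]) (simp_all add: degree_monom_eq)
  qed
  then show "commutation_defect (nodes a) (monom 1 (i + j)) = 0"
    by (simp add: mult_monom)
qed

section \<open>Characterisation of the admissible degrees\<close>

theorem proposition4:
  fixes k l m n \<alpha> \<beta> :: nat
  assumes "l \<ge> 1" and "n \<ge> 1"
    and "\<alpha> = max (2 * l) k" and "\<beta> = max (2 * n) m"
  shows "(\<forall>j\<in>solution_points \<alpha> \<beta>. basis \<alpha> \<beta> j \<in> QPspace \<alpha> \<beta>) \<and>
    represents_solutions k m \<alpha> \<beta> \<and>
    (\<forall>x y t. space_time_element l n x y t \<longrightarrow> discrete_GCL \<alpha> \<beta> x y t) \<and>
    (\<forall>a b. (a, b) \<noteq> (0, 0) \<longrightarrow>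
       ((represents_solutions k m a b \<and>
         (\<forall>x y t. space_time_element l n x y t \<longrightarrow> discrete_GCL a b x y t))
        \<longleftrightarrow> \<alpha> \<le> a \<and> \<beta> \<le> b))"
proof -
  have GCL: "discrete_GCL a b x y t"
    if "space_time_element l n x y t" "2 * l \<le> a" "2 * n \<le> b" for a b x y t
    using that exact_metrics_discrete_GCL unfolding space_time_element_def by blast
  have necessary: "2 * l \<le> a \<and> 2 * n \<le> b"
    if "(a, b) \<noteq> (0, 0)" "\<forall>x y t. space_time_element l n x y t \<longrightarrow> discrete_GCL a b x y t" for a b
  proof -
    have a: "1 \<le> a"
      using GCL_imp_spatial_degree_positive assms(1,2) that by blast
    have b: "2 * n \<le> b"
      using GCL_imp_temporal_degree assms(1,2) a that(2) by blast
    then have "2 \<le> b"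
      using assms(2) by linarith
    then show ?thesis
      using GCL_imp_spatial_degree assms(1,2) a b that(2) by blast
  qed
  show ?thesis
    unfolding represents_solutions_iff assms(3,4) max.bounded_iff
    using basis_in_QPspace GCL necessary by (simp; blast)
qed

end
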